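(* Let $k\ge1$, let $\lambda=(a|b)$ be a hook partition of $2^k$, and let $T$ be a 1-2 binary tree of height $k$. Let $r_{\lambda T}=\langle\chi_\lambda,\chi_T\rangle_{H_k}$ be the multiplicity of the irreducible character $\chi_T$ of $H_k$ in the restriction to $H_k$ of the irreducible character $\chi_\lambda$ of $S_{2^k}$ (and similarly $r_{\mu U}$ for partitions $\mu$ of $2^{k-1}$ and trees $U$ of height $k-1$). Then $$r_{\lambda T}=\begin{cases}A(T_1,\lambda)+\frac12 r_{\frac\lambda2 T_1}^2+\frac{\mathrm{ext}(T)(-1)^{\mathrm{vert}(\lambda)}}{2}\,r_{\frac\lambda2 T_1} & \text{if } T=(r,\{T_1,T_1\}) \text{ (Type I) or } T=(r,\{T_1\}) \text{ (Type II)},\\[4pt] B(T_1,T_2,\lambda)+r_{\frac\lambda2T_1}r_{\frac\lambda2T_2} & \text{if } T=(r,\{T_1,T_2\}),\ T_1\ne T_2 \text{ (Type III)},\end{cases}$$ where $\mathrm{ext}(T)=1$ if $T$ is of Type I and $\mathrm{ext}(T)=-1$ if $T$ is of Type II, and $$A(T_1,\lambda)=\sum_{(a_1|b_1)} r_{(a_1|b_1)T_1}\left(r_{(a-a_1|b-b_1-1)T_1}+r_{(a-a_1-1|b-b_1)T_1}\right),$$ $$B(T_1,T_2,\lambda)=\sum_{(a_1|b_1)}\Big[ r_{(a_1|b_1)T_1}\left(r_{(a-a_1|b-b_1-1)T_2}+r_{(a-a_1-1|b-b_1)T_2}\right)+r_{(a_1|b_1)T_2}\left(r_{(a-a_1|b-b_1-1)T_1}+r_{(a-a_1-1|b-b_1)T_1}\right)\Big],$$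 both sums being over the hook partitions $(a_1|b_1)$ of $2^{k-1}$ with $(a_1|b_1)\neq\frac\lambda2$ and $a\ge a_1>\frac a2$.
   Context: Hooks. $(a|b)$ denotes the hook partition $(a+1,1^b)$ of $a+b+1$, $a,b\ge0$; a term $r_{(x|y)U}$ with $x<0$ or $y<0$ is read as $0$. For a hook $\lambda=(a|b)$ of even size, exactly one of $a,b$ is odd; $\frac\lambda2=(\frac{a-1}2|\frac b2)$ if $a$ is odd and $\frac\lambda2=(\frac a2|\frac{b-1}2)$ if $a$ is even. Such a hook shape has a unique tiling by dominoes, and $\mathrm{vert}(\lambda)$ is the number of vertical dominoes in it. Groups. $H_0$ is trivial and, for $k\ge1$, $H_k=H_{k-1}\wr C_2$ with $C_2=\{\pm1\}$: elements are $(\sigma_1,\sigma_2)^{\epsilon}$ with $\sigma_i\in H_{k-1}$, $\epsilon\in\{\pm1\}$, and $(\sigma_1,\sigma_2)^{1}(\tau_1,\tau_2)^{\epsilon}=(\sigma_1\tau_1,\sigma_2\tau_2)^{\epsilon}$, $(\sigma_1,\sigma_2)^{-1}(\tau_1,\tau_2)^{\epsilon}=(\sigma_1\tau_2,\sigma_2\tau_1)^{-\epsilon}$. $H_k$ is a Sylow 2-subgroup of $S_{2^k}$, embedded recursively: $H_{k-1}\times H_{k-1}\subset S_{2^{k-1}}\times S_{2^{k-1}}\subset S_{2^k}$ acts on the two halves of $\{1,\dots,2^k\}$, and $(\mathrm{Id},\mathrm{Id})^{-1}$ swaps the two halves, $i\leftrightarrow i+2^{k-1}$. Irreducible complex representations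 of $H_k$, $k\ge1$. For $\phi$ irreducible for $H_{k-1}$, $\mathrm{Ext}^{\pm}(\phi)$ are the two extensions of $\phi\otimes\phi$ from $H_{k-1}\times H_{k-1}$ to $H_k$, with character value $\pm\phi(\sigma_1\sigma_2)$ at $(\sigma_1,\sigma_2)^{-1}$. For nonisomorphic irreducibles $\phi_1,\phi_2$ of $H_{k-1}$, $\mathrm{Ind}(\phi_1,\phi_2)=\mathrm{Ind}_{H_{k-1}\times H_{k-1}}^{H_k}(\phi_1\otimes\phi_2)$. These are all the irreducibles of $H_k$. Trees. A 1-2 binary tree of height $0$ is a single root vertex $(r,\emptyset)$; one of height $k\ge1$ is $(r,M)$ with $M$ a multiset of one or two 1-2 binary trees of height $k-1$. The irreducible character $\chi_T$ of $H_k$ attached to a tree $T$ of height $k$ is: the trivial character of $H_0$ for $k=0$; $\mathrm{Ext}^+(\chi_{T_1})$ for $T=(r,\{T_1,T_1\})$; $\mathrm{Ext}^-(\chi_{T_1})$ for $T=(r,\{T_1\})$; $\mathrm{Ind}(\chi_{T_1},\chi_{T_2})$ for $T=(r,\{T_1,T_2\})$ with $T_1\ne T_2$. $\chi_\lambda$ is the irreducible character of the symmetric group indexed by $\lambda$ (with $(n)$ the trivial character), and $\langle\chi_1,\chi_2\rangle_G=\frac1{|G|}\sum_{g\in G}\chi_1(g^{-1})\chi_2(g)$.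
   Formalization: For even a both sums run over a/2 ≤ a_1 ≤ a, and the condition (a_1|b_1) ≠ λ/2 only drops the terms r_{(a-a_1|b-b_1-1)} at λ/2; as printed the formula fails: for λ=(2|1) and T={T_1,T_2} of degree 2 it gives 0 instead of 1. *)

theory Defs
  imports
    Complex_Main
    "HOL-Library.Multiset"
    "HOL-Library.Function_Algebras"
    "HOL-Combinatorics.Permutations"
    "HOL-Algebra.Group"
begin

section \<open>Irreducible characters of symmetric groups: Specht modules\<close>

text \<open>
  A partition is the list of its parts in weakly decreasing order; cells are
  (row, column) pairs counted from 0.  A tableau of shape \<open>l\<close> is a bijection from
  the cells to \<open>{1..n}\<close>; only its values on the diagram matter.
\<close>

definition diagram :: "nat list \<Rightarrow> (nat \<times> nat) set" where
  "diagram l = {(i, j). i < length l \<and> j < l ! i}"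

definition is_tableau :: "nat list \<Rightarrow> (nat \<times> nat \<Rightarrow> nat) \<Rightarrow> bool" where
  "is_tableau l t \<longleftrightarrow> bij_betw t (diagram l) {1..sum_list l}"

text \<open>A tabloid is given by its sequence of row contents.\<close>

type_synonym tabloid = "nat \<Rightarrow> nat set"

definition tabloid_of :: "nat list \<Rightarrow> (nat \<times> nat \<Rightarrow> nat) \<Rightarrow> tabloid" where
  "tabloid_of l t = (\<lambda>i. t ` {c \<in> diagram l. fst c = i})"

definition column_group :: "nat list \<Rightarrow> (nat \<times> nat \<Rightarrow> nat) \<Rightarrow> (nat \<Rightarrow> nat) set" where
  "column_group l t = {p. p permutes {1..sum_list l} \<and>
     (\<forall>j. p ` t ` {c \<in> diagram l. snd c = j} = t ` {c \<in> diagram l. snd c = j})}"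

definition fscale :: "complex \<Rightarrow> ('a \<Rightarrow> complex) \<Rightarrow> 'a \<Rightarrow> complex" where
  "fscale c v = (\<lambda>x. c * v x)"

interpretation fun_space: vector_space "fscale :: complex \<Rightarrow> ('a \<Rightarrow> complex) \<Rightarrow> 'a \<Rightarrow> complex"
  by unfold_locales (auto simp: fscale_def fun_eq_iff algebra_simps)

definition basis_vector :: "'a \<Rightarrow> 'a \<Rightarrow> complex" where
  "basis_vector x = (\<lambda>y. if y = x then 1 else 0)"

definition polytabloid :: "nat list \<Rightarrow> (nat \<times> nat \<Rightarrow> nat) \<Rightarrow> tabloid \<Rightarrow> complex" where
  "polytabloid l t =
     (\<Sum>p \<in> column_group l t. fscale (of_int (sign p)) (basis_vector (tabloid_of l (p \<circ> t))))"

definition specht :: "nat list \<Rightarrow> (tabloid \<Rightarrow> complex) set" where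
  "specht l = fun_space.span {polytabloid l t | t. is_tableau l t}"

text \<open>
  The action of a permutation sends the basis vector of the tabloid \<open>U\<close> to that of
  \<open>\<lambda>i. p ` U i\<close>; on coefficient functions this is precomposition with the inverse of
  \<open>p\<close>, and the image under the inverse of \<open>p\<close> is the preimage under \<open>p\<close>.
\<close>

definition tabloid_action :: "(nat \<Rightarrow> nat) \<Rightarrow> (tabloid \<Rightarrow> complex) \<Rightarrow> tabloid \<Rightarrow> complex" where
  "tabloid_action p v = (\<lambda>U. v (\<lambda>i. p -` U i))"

text \<open>Trace of a linear map on an invariant finite-dimensional subspace \<open>W\<close>.\<close>

definition trace_on :: "('a \<Rightarrow> complex) set \<Rightarrow> (('a \<Rightarrow> complex) \<Rightarrow> 'a \<Rightarrow> complex) \<Rightarrow> complex" where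
  "trace_on W f =
     (let B = (SOME B. B \<subseteq> W \<and> fun_space.independent B \<and> fun_space.span B = W)
      in \<Sum>b\<in>B. fun_space.representation B (f b) b)"

definition sym_char :: "nat list \<Rightarrow> (nat \<Rightarrow> nat) \<Rightarrow> complex" where
  "sym_char l p = trace_on (specht l) (tabloid_action p)"


section \<open>Hooks and dominoes\<close>

text \<open>The pair \<open>(a, b)\<close> stands for the hook \<open>(a|b) = (a + 1, 1\<^sup>b)\<close>.\<close>

definition hook :: "nat \<times> nat \<Rightarrow> nat list" where
  "hook = (\<lambda>(a, b). (a + 1) # replicate b 1)"

definition half_hook :: "nat \<times> nat \<Rightarrow> nat \<times> nat" where
  "half_hook = (\<lambda>(a, b). if odd a then ((a - 1) div 2, b div 2) else (a div 2, (b - 1) div 2))"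

definition horizontal_domino :: "(nat \<times> nat) set \<Rightarrow> bool" where
  "horizontal_domino d \<longleftrightarrow> (\<exists>i j. d = {(i, j), (i, j + 1)})"

definition vertical_domino :: "(nat \<times> nat) set \<Rightarrow> bool" where
  "vertical_domino d \<longleftrightarrow> (\<exists>i j. d = {(i, j), (i + 1, j)})"

definition domino_tiling :: "(nat \<times> nat) set set \<Rightarrow> (nat \<times> nat) set \<Rightarrow> bool" where
  "domino_tiling P D \<longleftrightarrow>
     (\<forall>d\<in>P. horizontal_domino d \<or> vertical_domino d) \<and> pairwise disjnt P \<and> \<Union>P = D"

text \<open>Meaningful for shapes with a unique domino tiling, such as hooks of even size.\<close>

definition vert :: "nat list \<Rightarrow> nat" where
  "vert l = card {d \<in> (THE P. domino_tiling P (diagram l)). vertical_domino d}"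


section \<open>The Sylow subgroups\<close>

text \<open>\<open>Wr s1 s2 e\<close> is the element \<open>(s1, s2)\<^sup>e\<close>, with \<open>e\<close> equal to 1 or -1.\<close>

datatype wr_elt = Triv | Wr wr_elt wr_elt int

definition wreath_C2 :: "wr_elt monoid \<Rightarrow> wr_elt monoid" where
  "wreath_C2 G =
    \<lparr> carrier = {Wr s1 s2 e | s1 s2 e. s1 \<in> carrier G \<and> s2 \<in> carrier G \<and> e \<in> {1, -1}},
      monoid.mult = (\<lambda>x y. case (x, y) of
         (Wr s1 s2 e, Wr t1 t2 d) \<Rightarrow>
           (if e = 1 then Wr (s1 \<otimes>\<^bsub>G\<^esub> t1) (s2 \<otimes>\<^bsub>G\<^esub> t2) d
            else Wr (s1 \<otimes>\<^bsub>G\<^esub> t2) (s2 \<otimes>\<^bsub>G\<^esub> t1) (- d))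
       | _ \<Rightarrow> Triv),
      one = Wr \<one>\<^bsub>G\<^esub> \<one>\<^bsub>G\<^esub> 1 \<rparr>"

primrec H_group :: "nat \<Rightarrow> wr_elt monoid" where
  "H_group 0 = \<lparr> carrier = {Triv}, monoid.mult = (\<lambda>_ _. Triv), one = Triv \<rparr>"
| "H_group (Suc k) = wreath_C2 (H_group k)"

definition base_subgroup :: "nat \<Rightarrow> wr_elt set" where
  "base_subgroup k = {Wr s1 s2 1 | s1 s2. s1 \<in> carrier (H_group k) \<and> s2 \<in> carrier (H_group k)}"

definition block_perm :: "nat \<Rightarrow> (nat \<Rightarrow> nat) \<Rightarrow> (nat \<Rightarrow> nat) \<Rightarrow> nat \<Rightarrow> nat" where
  "block_perm m p q i = (if i \<le> m then p i else q (i - m) + m)"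

definition swap_halves :: "nat \<Rightarrow> nat \<Rightarrow> nat" where
  "swap_halves m i =
     (if 1 \<le> i \<and> i \<le> m then i + m else if m < i \<and> i \<le> 2 * m then i - m else i)"

text \<open>
  The embedding of \<open>H_group k\<close> into the permutations of \<open>{1..2 ^ k}\<close>; by the product rule
  \<open>Wr s1 s2 (-1)\<close> is \<open>Wr s1 s2 1\<close> times the swap of the two halves.
\<close>

fun H_perm :: "nat \<Rightarrow> wr_elt \<Rightarrow> nat \<Rightarrow> nat" where
  "H_perm (Suc k) (Wr s1 s2 e) =
     (if e = 1 then block_perm (2 ^ k) (H_perm k s1) (H_perm k s2)
      else block_perm (2 ^ k) (H_perm k s1) (H_perm k s2) \<circ> swap_halves (2 ^ k))"
| "H_perm _ _ = id"


section \<open>Trees and the irreducible characters of the Sylow subgroups\<close>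

datatype tree = Node "tree multiset"

inductive tree12 :: "nat \<Rightarrow> tree \<Rightarrow> bool" where
  "tree12 0 (Node {#})"
| "size M \<in> {1, 2} \<Longrightarrow> (\<And>U. U \<in># M \<Longrightarrow> tree12 k U) \<Longrightarrow> tree12 (Suc k) (Node M)"

text \<open>\<open>ext_char k e f\<close> is the character of the extension of sign \<open>e\<close> from height \<open>k\<close> to \<open>k + 1\<close>.\<close>

definition ext_char :: "nat \<Rightarrow> complex \<Rightarrow> (wr_elt \<Rightarrow> complex) \<Rightarrow> wr_elt \<Rightarrow> complex" where
  "ext_char k \<epsilon> f g = (case g of
      Wr s1 s2 e \<Rightarrow> if e = 1 then f s1 * f s2 else \<epsilon> * f (s1 \<otimes>\<^bsub>H_group k\<^esub> s2)
    | Triv \<Rightarrow> 0)"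

definition outer_tensor ::
  "(wr_elt \<Rightarrow> complex) \<Rightarrow> (wr_elt \<Rightarrow> complex) \<Rightarrow> wr_elt \<Rightarrow> complex" where
  "outer_tensor f1 f2 g = (case g of Wr s1 s2 e \<Rightarrow> f1 s1 * f2 s2 | Triv \<Rightarrow> 0)"

definition induced_char ::
  "('g, 'm) monoid_scheme \<Rightarrow> 'g set \<Rightarrow> ('g \<Rightarrow> complex) \<Rightarrow> 'g \<Rightarrow> complex" where
  "induced_char G S f g =
     (\<Sum>x \<in> {x \<in> carrier G. inv\<^bsub>G\<^esub> x \<otimes>\<^bsub>G\<^esub> g \<otimes>\<^bsub>G\<^esub> x \<in> S}. f (inv\<^bsub>G\<^esub> x \<otimes>\<^bsub>G\<^esub> g \<otimes>\<^bsub>G\<^esub> x)) / of_nat (card S)"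

text \<open>
  The two subtrees of a root with two children are picked in an arbitrary order; the induced
  character does not depend on it.
\<close>

primrec tree_char :: "nat \<Rightarrow> tree \<Rightarrow> wr_elt \<Rightarrow> complex" where
  "tree_char 0 T = (\<lambda>_. 1)"
| "tree_char (Suc k) T =
    (if \<exists>T1. T = Node {#T1#} then
       ext_char k (-1) (tree_char k (THE T1. T = Node {#T1#}))
     else
       let (T1, T2) = (SOME (T1, T2). T = Node {#T1, T2#}) in
       if T1 = T2 then ext_char k 1 (tree_char k T1)
       else induced_char (H_group (Suc k)) (base_subgroup k)
              (outer_tensor (tree_char k T1) (tree_char k T2)))"


section \<open>Multiplicities\<close>

definition char_inner ::
  "('g, 'm) monoid_scheme \<Rightarrow> ('g \<Rightarrow> complex) \<Rightarrow> ('g \<Rightarrow> complex) \<Rightarrow> complex" where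
  "char_inner G f1 f2 = (\<Sum>g \<in> carrier G. f1 (inv\<^bsub>G\<^esub> g) * f2 g) / of_nat (card (carrier G))"

text \<open>\<open>mult_r k l T\<close> is \<open>r\<^bsub>l T\<^esub>\<close> for a partition \<open>l\<close> of \<open>2 ^ k\<close> and a tree \<open>T\<close> of height \<open>k\<close>.\<close>

definition mult_r :: "nat \<Rightarrow> nat list \<Rightarrow> tree \<Rightarrow> complex" where
  "mult_r k l T = char_inner (H_group k) (\<lambda>g. sym_char l (H_perm k g)) (tree_char k T)"

definition hook_r :: "nat \<Rightarrow> int \<Rightarrow> int \<Rightarrow> tree \<Rightarrow> complex" where
  "hook_r k x y T = (if x < 0 \<or> y < 0 then 0 else mult_r k (hook (nat x, nat y)) T)"

definition ext_sign :: "tree \<Rightarrow> complex" where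
  "ext_sign T = (if \<exists>T1. T = Node {#T1, T1#} then 1
                 else if \<exists>T1. T = Node {#T1#} then -1 else 0)"

text \<open>
  In the sums below, \<open>k\<close> is the height of the subtrees (one less than that of the tree).

  The source sums over the hooks \<open>(a1|b1)\<close> of \<open>2 ^ k\<close>, different from half of \<open>(a|b)\<close>, with
  \<open>a/2 < a1 \<le> a\<close>.  For odd \<open>a\<close> that is exactly what is written here.  For even \<open>a\<close> the strict
  bound loses the pair \<open>(a/2 | (b-1)/2)\<close>, \<open>(a/2-1 | (b+1)/2)\<close> and the resulting formula is
  false (\<open>(a|b) = (2|1)\<close> restricted to the dihedral group contains the irreducible of degree 2,
  whereas the printed formula gives 0).  The bound is therefore \<open>a/2 \<le> a1 \<le> a\<close>, and the
  condition of being different from half of \<open>(a|b)\<close>, which is redundant under the strict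
  bound, excludes exactly the pairing of half of \<open>(a|b)\<close> with itself: if \<open>(a1|b1)\<close> is half of
  \<open>(a|b)\<close> and \<open>a\<close> is even then \<open>(a-a1|b-b1-1)\<close> is half of \<open>(a|b)\<close> too.
\<close>

definition hook_range :: "nat \<Rightarrow> nat \<Rightarrow> (nat \<times> nat) set" where
  "hook_range k a = {(a1, b1). a1 + b1 + 1 = 2 ^ k \<and> a1 \<le> a \<and> real a1 \<ge> real a / 2}"

definition partner_r :: "nat \<Rightarrow> nat \<times> nat \<Rightarrow> nat \<times> nat \<Rightarrow> tree \<Rightarrow> complex" where
  "partner_r k = (\<lambda>(a, b) (a1, b1) U.
     (if (a1, b1) \<noteq> half_hook (a, b)
      then hook_r k (int a - int a1) (int b - int b1 - 1) U else 0)
     + hook_r k (int a - int a1 - 1) (int b - int b1) U)"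

definition A_sum :: "nat \<Rightarrow> tree \<Rightarrow> nat \<times> nat \<Rightarrow> complex" where
  "A_sum k T1 = (\<lambda>(a, b). \<Sum>(a1, b1) \<in> hook_range k a.
     mult_r k (hook (a1, b1)) T1 * partner_r k (a, b) (a1, b1) T1)"

definition B_sum :: "nat \<Rightarrow> tree \<Rightarrow> tree \<Rightarrow> nat \<times> nat \<Rightarrow> complex" where
  "B_sum k T1 T2 = (\<lambda>(a, b). \<Sum>(a1, b1) \<in> hook_range k a.
     mult_r k (hook (a1, b1)) T1 * partner_r k (a, b) (a1, b1) T2
     + mult_r k (hook (a1, b1)) T2 * partner_r k (a, b) (a1, b1) T1)"

end

theory Submission
  imports
    Defs
    "HOL-Combinatorics.Orbits"
    "HOL-Computational_Algebra.Formal_Power_Series"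
begin

text \<open>
  The Specht module of \<open>(a|b)\<close> is the \<open>b\<close>-th exterior power of the standard
  representation of the symmetric group on \<open>n = a + b + 1\<close> letters, so the generating
  function of the hook characters at \<open>\<sigma>\<close> is \<open>det (1 + X \<sigma>) / (1 + X)\<close>, with
  \<open>\<sigma>\<close> acting on the permutation representation.  The determinant is multiplicative on
  block permutations, and at \<open>(\<sigma>\<^sub>1, \<sigma>\<^sub>2)\<close> followed by the swap of the halves
  it is \<open>det (1 - X\<^sup>2 \<sigma>\<^sub>1\<sigma>\<^sub>2)\<close>.  Dividing by \<open>1 + X\<close> expresses
  the hook characters of size \<open>2m\<close> on the wreath product through those of size \<open>m\<close>:
  the base group contributes all products of hooks \<open>(a\<^sub>1|b\<^sub>1)\<close>,
  \<open>(a\<^sub>2|b\<^sub>2)\<close> with \<open>b\<^sub>1 + b\<^sub>2\<close> equal to \<open>b\<close> or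
  \<open>b - 1\<close>, and the other coset contributes the half of \<open>(a|b)\<close> up to sign.
\<close>

section \<open>Traces on function spaces\<close>

text \<open>\<open>specht\<close> is a span and \<open>trace_on\<close> takes an unspecified basis,
  so the trace needs explicit coordinates. Describing the module by linear conditions supplies them:
  a cone argument at the entry 1 shows that the coefficients at sequences avoiding 1 determine a
  vector. The price is a trace formula that singles out the point 1 and does not look like a class
  function. Multiplication by \<open>1 + X\<close> removes the asymmetry, and cancelling it again in
  the integral domain of integer power series carries results back.

  The shape of the recursion comes from this factor. On the base group
  \<open>(1 + X)^2 / (1 + X)\<close> leaves \<open>1 + X\<close>, hence two antidiagonals,
  \<open>b\<close> and \<open>b - 1\<close>. On the other coset \<open>(1 - X^2) / (1 + X)\<close>
  leaves \<open>1 - X\<close>, hence one term in each degree. Exactly one of \<open>b\<close> and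
  \<open>b - 1\<close> is even, so exactly one antidiagonal has a middle term. It is the product of
  the multiplicities of the half hook. All other terms fall into pairs exchanged by reflection,
  which is why the sums run over half of the hooks.\<close>

lemma sum_fun_apply: "(\<Sum>i\<in>I. g i) x = (\<Sum>i\<in>I. g i x)"
  by (induction I rule: infinite_finite_induct) auto

text \<open>\<open>expand\<close> factors the identity of \<open>W\<close> through the functions on
  \<open>I\<close>: evaluate at the \<open>u i\<close>, then combine the \<open>w i\<close>.
  Cyclicity of the trace turns the trace of \<open>f\<close> into that of the matrix with entries
  \<open>f (w j) (u i)\<close>, whichever basis \<open>trace_on\<close> chooses.\<close>

lemma trace_on_eq_sum:
  fixes f :: "('a \<Rightarrow> complex) \<Rightarrow> 'a \<Rightarrow> complex"
  assumes fin: "finite I" and W: "fun_space.subspace W" and w: "\<And>i. i \<in> I \<Longrightarrow> w i \<in> W"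
    and lin: "Vector_Spaces.linear fscale fscale f" and fW: "\<And>v. v \<in> W \<Longrightarrow> f v \<in> W"
    and expand: "\<And>v. v \<in> W \<Longrightarrow> v = (\<Sum>i\<in>I. fscale (v (u i)) (w i))"
  shows "trace_on W f = (\<Sum>i\<in>I. f (w i) (u i))"
proof -
  interpret f: Vector_Spaces.linear fscale fscale f by (fact lin)
  define B where "B = (SOME B. B \<subseteq> W \<and> fun_space.independent B \<and> fun_space.span B = W)"
  obtain B0 where B0: "B0 \<subseteq> W" "fun_space.independent B0" "W \<subseteq> fun_space.span B0"
    by (rule fun_space.maximal_independent_subset)
  then have ex: "B0 \<subseteq> W \<and> fun_space.independent B0 \<and> fun_space.span B0 = W"
    using fun_space.span_minimal[OF B0(1) W] by auto
  have "B \<subseteq> W \<and> fun_space.independent B \<and> fun_space.span B = W"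
    unfolding B_def using ex by (rule someI)
  then have B: "B \<subseteq> W" "fun_space.independent B" "fun_space.span B = W" by auto
  \<comment> \<open>A finite spanning set makes the chosen basis \<open>B\<close> finite; over an
    infinite \<open>B\<close> the sum would be the default value 0.\<close>
  have "W \<subseteq> fun_space.span (w ` I)"
  proof
    fix v assume "v \<in> W"
    show "v \<in> fun_space.span (w ` I)"
      by (subst expand[OF \<open>v \<in> W\<close>])
        (auto intro!: fun_space.span_sum fun_space.span_scale intro: fun_space.span_base)
  qed
  then have finB: "finite B"
    using fun_space.independent_span_bound[of "w ` I" B] fin B by auto
  have rep_f: "fun_space.representation B (f b) b
      = (\<Sum>i\<in>I. b (u i) * fun_space.representation B (f (w i)) b)" if "b \<in> B" for b
  proof -
    have "b \<in> W" using that B by auto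
    have "f b = f (\<Sum>i\<in>I. fscale (b (u i)) (w i))"
      using expand[OF \<open>b \<in> W\<close>] by (rule arg_cong)
    also have "\<dots> = (\<Sum>i\<in>I. fscale (b (u i)) (f (w i)))"
      by (simp add: f.sum f.scale)
    finally have "fun_space.representation B (f b)
        = fun_space.representation B (\<Sum>i\<in>I. fscale (b (u i)) (f (w i)))"
      by (rule arg_cong)
    also have "\<dots> = (\<lambda>c. \<Sum>i\<in>I. fun_space.representation B (fscale (b (u i)) (f (w i))) c)"
      by (rule fun_space.representation_sum) (auto simp: B w fW W intro: fun_space.subspace_scale)
    also have "\<dots> = (\<lambda>c. \<Sum>i\<in>I. b (u i) * fun_space.representation B (f (w i)) c)"
      by (auto simp: fun_eq_iff B w fW fun_space.representation_scale intro!: sum.cong)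
    finally show ?thesis by (simp add: fun_eq_iff)
  qed
  have "trace_on W f = (\<Sum>b\<in>B. fun_space.representation B (f b) b)"
    by (simp add: trace_on_def B_def Let_def)
  also have "\<dots> = (\<Sum>b\<in>B. \<Sum>i\<in>I. b (u i) * fun_space.representation B (f (w i)) b)"
    by (simp add: rep_f)
  also have "\<dots> = (\<Sum>i\<in>I. (\<Sum>b\<in>B. fscale (fun_space.representation B (f (w i)) b) b) (u i))"
    by (subst sum.swap) (simp add: sum_fun_apply fscale_def mult.commute)
  also have "\<dots> = (\<Sum>i\<in>I. f (w i) (u i))"
    by (rule sum.cong, rule refl, subst fun_space.sum_representation_eq) (auto simp: B finB w fW)
  finally show ?thesis .
qed

section \<open>Specht modules of hooks\<close>

text \<open>A tabloid of hook shape is determined by the entries \<open>x 1\<close>, ...,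
  \<open>x b\<close> below its first row. The corner entry \<open>x 0\<close> disappears in the
  first row, although \<open>hook_vec\<close> permutes it along with the others.\<close>

definition row_tabloid :: "nat \<Rightarrow> nat \<Rightarrow> (nat \<Rightarrow> nat) \<Rightarrow> tabloid" where
  "row_tabloid n b x i = (if i = 0 then {1..n} - x ` {1..b} else if i \<le> b then {x i} else {})"

definition hook_vec :: "nat \<Rightarrow> nat \<Rightarrow> (nat \<Rightarrow> nat) \<Rightarrow> tabloid \<Rightarrow> complex" where
  "hook_vec n b x = (\<Sum>p | p permutes x ` {..b}.
     fscale (of_int (sign p)) (basis_vector (row_tabloid n b (p \<circ> x))))"

text \<open>
  Alternating chains on \<open>{1..n}\<close>, seen as functions of the sequence of entries in rows
  \<open>1, \<dots>, b\<close>, with vanishing boundary.  Such a chain is determined by its values on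
  the sequences avoiding the entry 1, which gives a basis of the Specht module of a hook.
\<close>

definition hook_space :: "nat \<Rightarrow> nat \<Rightarrow> (tabloid \<Rightarrow> complex) set" where
  "hook_space n b = {v.
     (\<forall>U. v U \<noteq> 0 \<longrightarrow> (\<exists>y. inj_on y {1..b} \<and> y ` {1..b} \<subseteq> {1..n} \<and> U = row_tabloid n b y)) \<and>
     (\<forall>y. \<forall>i\<in>{1..b}. \<forall>j\<in>{1..b}. i \<noteq> j \<longrightarrow>
        v (row_tabloid n b (y \<circ> transpose i j)) = - v (row_tabloid n b y)) \<and>
     (b \<ge> 1 \<longrightarrow> (\<forall>y. (\<Sum>c\<in>{1..n}. v (row_tabloid n b (y(1 := c)))) = 0))}"

lemma hook_spaceI:
  assumes "\<And>U. v U \<noteq> 0 \<Longrightarrow>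
      \<exists>y. inj_on y {1..b} \<and> y ` {1..b} \<subseteq> {1..n} \<and> U = row_tabloid n b y"
    and "\<And>y i j. i \<in> {1..b} \<Longrightarrow> j \<in> {1..b} \<Longrightarrow> i \<noteq> j \<Longrightarrow>
      v (row_tabloid n b (y \<circ> transpose i j)) = - v (row_tabloid n b y)"
    and "\<And>y. b \<ge> 1 \<Longrightarrow> (\<Sum>c\<in>{1..n}. v (row_tabloid n b (y(1 := c)))) = 0"
  shows "v \<in> hook_space n b"
  using assms unfolding hook_space_def by blast

lemma hook_spaceD:
  assumes "v \<in> hook_space n b"
  shows "v U \<noteq> 0 \<Longrightarrow>
      \<exists>y. inj_on y {1..b} \<and> y ` {1..b} \<subseteq> {1..n} \<and> U = row_tabloid n b y"
    and "i \<in> {1..b} \<Longrightarrow> j \<in> {1..b} \<Longrightarrow> i \<noteq> j \<Longrightarrow>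
      v (row_tabloid n b (y \<circ> transpose i j)) = - v (row_tabloid n b y)"
    and "b \<ge> 1 \<Longrightarrow> (\<Sum>c\<in>{1..n}. v (row_tabloid n b (y(1 := c)))) = 0"
  using assms unfolding hook_space_def by blast+

lemma row_tabloid_cong:
  assumes "\<And>i. i \<in> {1..b} \<Longrightarrow> x i = y i"
  shows "row_tabloid n b x = row_tabloid n b y"
proof -
  have "x ` {1..b} = y ` {1..b}" using assms by (rule image_cong[OF refl])
  then show ?thesis using assms by (auto simp: row_tabloid_def fun_eq_iff)
qed

lemma row_tabloid_eq_iff:
  "row_tabloid n b x = row_tabloid n b y \<longleftrightarrow> (\<forall>i\<in>{1..b}. x i = y i)"
proof
  assume "row_tabloid n b x = row_tabloid n b y"
  then have eq: "row_tabloid n b x i = row_tabloid n b y i" for i by simp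
  show "\<forall>i\<in>{1..b}. x i = y i"
  proof
    fix i assume "i \<in> {1..b}"
    then show "x i = y i" using eq[of i] by (auto simp: row_tabloid_def)
  qed
qed (rule row_tabloid_cong, simp)

lemma hook_vec_apply:
  "hook_vec n b x U
    = (\<Sum>p | p permutes x ` {..b} \<and> row_tabloid n b (p \<circ> x) = U. of_int (sign p))"
proof -
  have "hook_vec n b x U = (\<Sum>p | p permutes x ` {..b}.
      if row_tabloid n b (p \<circ> x) = U then of_int (sign p) else 0)"
    by (auto simp: hook_vec_def sum_fun_apply fscale_def basis_vector_def intro!: sum.cong)
  then show ?thesis
    by (simp add: sum.inter_filter[symmetric] finite_permutations)
qed

lemma hook_vec_row_tabloid:
  "hook_vec n b x (row_tabloid n b y)
    = (\<Sum>p | p permutes x ` {..b} \<and> (\<forall>i\<in>{1..b}. p (x i) = y i). of_int (sign p))"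
  by (simp add: hook_vec_apply row_tabloid_eq_iff)

lemma sign_comp_transpose:
  assumes "finite A" "p permutes A"
  shows "sign (p \<circ> transpose u v) = (if u = v then sign p else - sign p)"
  using assms
  by (subst sign_compose) (auto simp: sign_swap_id permutation_swap_id intro: permutes_imp_permutation)

text \<open>Composition with a transposition is a sign-reversing bijection between the two sets of
  permutations. It gives alternation when \<open>P\<close> and \<open>Q\<close> differ, and
  vanishing when they coincide.\<close>

lemma sum_sign_transpose:
  assumes "finite A" "u \<in> A" "v \<in> A" "u \<noteq> v"
    and "\<And>p. p permutes A \<Longrightarrow> P (p \<circ> transpose u v) \<longleftrightarrow> Q p"
  shows "(\<Sum>p | p permutes A \<and> P p. of_int (sign p))
    = - (\<Sum>p | p permutes A \<and> Q p. of_int (sign p) :: 'a :: ring_1)"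
proof -
  have perm: "p \<circ> transpose u v permutes A" if "p permutes A" for p
    using that assms by (auto intro: permutes_compose permutes_swap_id)
  have "(\<Sum>p | p permutes A \<and> P p. of_int (sign p))
      = (\<Sum>p | p permutes A \<and> Q p. - (of_int (sign p)) :: 'a)"
    using assms perm
    by (intro sum.reindex_bij_witness[of _ "\<lambda>p. p \<circ> transpose u v" "\<lambda>p. p \<circ> transpose u v"])
      (auto simp: comp_assoc sign_comp_transpose assms(5)[OF perm, symmetric])
  then show ?thesis by (simp add: sum_negf)
qed

lemma hook_vec_in_hook_space:
  assumes "inj_on x {..b}" "x ` {..b} \<subseteq> {1..n}"
  shows "hook_vec n b x \<in> hook_space n b"
proof -
  have "\<exists>y. inj_on y {1..b} \<and> y ` {1..b} \<subseteq> {1..n} \<and> U = row_tabloid n b y"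
    if "hook_vec n b x U \<noteq> 0" for U
  proof -
    have "{p. p permutes x ` {..b} \<and> row_tabloid n b (p \<circ> x) = U} \<noteq> {}"
      using that unfolding hook_vec_apply by (metis sum.empty)
    then obtain p where p: "p permutes x ` {..b}" "row_tabloid n b (p \<circ> x) = U" by auto
    have "inj_on (p \<circ> x) {1..b}"
      using assms p(1) by (intro comp_inj_on) (auto intro: inj_on_subset permutes_inj_on)
    moreover have "(p \<circ> x) ` {1..b} \<subseteq> {1..n}"
    proof
      fix u assume "u \<in> (p \<circ> x) ` {1..b}"
      then obtain i where "i \<in> {1..b}" "u = p (x i)" by auto
      then have "u \<in> x ` {..b}" using permutes_in_image[OF p(1)] by auto
      then show "u \<in> {1..n}" using assms by auto
    qed
    ultimately show ?thesis using p(2) by metis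
  qed
  moreover have "hook_vec n b x (row_tabloid n b (y \<circ> transpose i j))
      = - hook_vec n b x (row_tabloid n b y)"
    if ij: "i \<in> {1..b}" "j \<in> {1..b}" "i \<noteq> j" for y i j
    unfolding hook_vec_row_tabloid
  proof (rule sum_sign_transpose[of _ "x i" "x j"])
    show "x i \<noteq> x j" using ij assms by (auto dest: inj_onD)
    fix p
    have tr: "transpose (x i) (x j) (x l) = x (transpose i j l)" if "l \<in> {1..b}" for l
    proof -
      have "x l = x i \<longleftrightarrow> l = i" "x l = x j \<longleftrightarrow> l = j"
        using that ij by (auto intro!: inj_on_eq_iff[OF assms(1)])
      then show ?thesis by (auto simp: transpose_def)
    qed
    have tij: "transpose i j l \<in> {1..b}" if "l \<in> {1..b}" for l
      using that ij by (auto simp: transpose_def)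
    have "(\<forall>l\<in>{1..b}. p (x (transpose i j l)) = (y \<circ> transpose i j) l)
      \<longleftrightarrow> (\<forall>l\<in>{1..b}. p (x l) = y l)"
      using tij by (metis comp_apply transpose_involutory)
    then show "(\<forall>l\<in>{1..b}. (p \<circ> transpose (x i) (x j)) (x l) = (y \<circ> transpose i j) l)
      \<longleftrightarrow> (\<forall>l\<in>{1..b}. p (x l) = y l)"
      using tr by auto
  qed (use ij in auto)
  moreover have "(\<Sum>c\<in>{1..n}. hook_vec n b x (row_tabloid n b (y(1 := c)))) = 0"
    if b: "b \<ge> 1" for y
  proof -
    \<comment> \<open>Summing over the entry of row 1 frees \<open>p (x 1)\<close>, and
      \<open>p (x 0)\<close> is free anyway. Composing with the transposition of \<open>x 0\<close>
      and \<open>x 1\<close> then cancels the permutations in pairs.\<close>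
    let ?R = "{p. p permutes x ` {..b} \<and> (\<forall>i\<in>{2..b}. p (x i) = y i)}"
    have "(\<Sum>p\<in>?R. of_int (sign p) :: complex) = - (\<Sum>p\<in>?R. of_int (sign p))"
    proof (rule sum_sign_transpose[of _ "x 0" "x 1"])
      show "x 0 \<noteq> x 1" using b assms by (auto dest: inj_onD)
      fix p
      have "x i \<noteq> x 0 \<and> x i \<noteq> x 1" if "i \<in> {2..b}" for i
        using that b assms(1) by (auto dest!: inj_onD)
      then show "(\<forall>i\<in>{2..b}. (p \<circ> transpose (x 0) (x 1)) (x i) = y i)
          \<longleftrightarrow> (\<forall>i\<in>{2..b}. p (x i) = y i)"
        by simp
    qed (use b in auto)
    then have R0: "(\<Sum>p\<in>?R. of_int (sign p) :: complex) = 0" by simp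
    have "(\<Sum>c\<in>{1..n}. hook_vec n b x (row_tabloid n b (y(1 := c))))
        = (\<Sum>c\<in>{1..n}. \<Sum>p | p \<in> ?R \<and> p (x 1) = c. of_int (sign p))"
      unfolding hook_vec_row_tabloid
    proof (rule sum.cong[OF refl])
      fix c
      have "{1..b} = insert 1 {2..b}" using b by auto
      then have "{p. p permutes x ` {..b} \<and> (\<forall>i\<in>{1..b}. p (x i) = (y(1 := c)) i)}
        = {p. p \<in> ?R \<and> p (x 1) = c}" by auto
      then show "(\<Sum>p | p permutes x ` {..b} \<and> (\<forall>i\<in>{1..b}. p (x i) = (y(1 := c)) i).
          of_int (sign p)) = (\<Sum>p | p \<in> ?R \<and> p (x 1) = c. of_int (sign p) :: complex)"
        by simp
    qed
    also have "\<dots> = (\<Sum>p\<in>?R. of_int (sign p))"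
    proof (rule sum.group)
      show "finite ?R" by (rule finite_subset[OF _ finite_permutations[of "x ` {..b}"]]) auto
      have "p (x 1) \<in> x ` {..b}" if "p \<in> ?R" for p
        using that b permutes_in_image[of p "x ` {..b}" "x 1"] by auto
      then show "(\<lambda>p. p (x 1)) ` ?R \<subseteq> {1..n}" using assms(2) by blast
    qed auto
    finally show ?thesis using R0 by simp
  qed
  ultimately show ?thesis unfolding hook_space_def by blast
qed

lemma subspace_hook_space: "fun_space.subspace (hook_space n b)"
proof (rule fun_space.subspaceI)
  show "0 \<in> hook_space n b" by (simp add: hook_space_def)
next
  fix v w assume vw: "v \<in> hook_space n b" "w \<in> hook_space n b"
  show "v + w \<in> hook_space n b"
  proof (rule hook_spaceI)
    fix U assume "(v + w) U \<noteq> 0"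
    then have "v U \<noteq> 0 \<or> w U \<noteq> 0" by auto
    then show "\<exists>y. inj_on y {1..b} \<and> y ` {1..b} \<subseteq> {1..n} \<and> U = row_tabloid n b y"
      using hook_spaceD(1)[OF vw(1)] hook_spaceD(1)[OF vw(2)] by metis
  qed (simp_all add: sum.distrib hook_spaceD(2,3)[OF vw(1), simplified]
      hook_spaceD(2,3)[OF vw(2), simplified])
next
  fix c v assume v: "v \<in> hook_space n b"
  show "fscale c v \<in> hook_space n b"
  proof (rule hook_spaceI)
    fix U assume "fscale c v U \<noteq> 0"
    then show "\<exists>y. inj_on y {1..b} \<and> y ` {1..b} \<subseteq> {1..n} \<and> U = row_tabloid n b y"
      using hook_spaceD(1)[OF v, of U] by (simp add: fscale_def)
  qed (simp_all add: fscale_def sum_distrib_left[symmetric] hook_spaceD(2,3)[OF v, simplified])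
qed

text \<open>HOL-Algebra occupies the notation for inverses.\<close>

abbreviation perm_inv :: "('a \<Rightarrow> 'b) \<Rightarrow> 'b \<Rightarrow> 'a" where
  "perm_inv \<equiv> inv_into UNIV"

text \<open>The first column of a tableau with 1 in the corner and the set \<open>S\<close> below
  it. The order of \<open>S\<close> is immaterial: changing it multiplies the polytabloid and the
  coordinate belonging to \<open>S\<close> by the same sign.\<close>

definition hook_enum :: "nat \<Rightarrow> nat set \<Rightarrow> nat \<Rightarrow> nat" where
  "hook_enum b S = (SOME x. x 0 = 1 \<and> bij_betw x {1..b} S)"

definition hook_index :: "nat \<Rightarrow> nat \<Rightarrow> nat set set" where
  "hook_index n b = {S. S \<subseteq> {2..n} \<and> card S = b}"

lemma finite_hook_index [simp]: "finite (hook_index n b)"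
  unfolding hook_index_def by (rule finite_subset[of _ "Pow {2..n}"]) auto

lemma hook_enum:
  assumes "S \<in> hook_index n b"
  shows "hook_enum b S 0 = 1" "bij_betw (hook_enum b S) {1..b} S"
proof -
  have "finite S" "card {1..b} = card S"
    using assms by (auto simp: hook_index_def intro: finite_subset)
  then obtain e where e: "bij_betw e {1..b} S"
    by (metis finite_atLeastAtMost finite_same_card_bij)
  have "bij_betw (e(0 := 1)) {1..b} S"
    using e by (subst bij_betw_cong[of _ _ e]) auto
  then have "\<exists>x. x 0 = (1::nat) \<and> bij_betw x {1..b} S"
    by (intro exI[of _ "e(0 := 1)"]) simp
  then have "hook_enum b S 0 = 1 \<and> bij_betw (hook_enum b S) {1..b} S"
    unfolding hook_enum_def by (rule someI_ex)
  then show "hook_enum b S 0 = 1" "bij_betw (hook_enum b S) {1..b} S" by auto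
qed

lemma hook_enum_image:
  assumes "S \<in> hook_index n b"
  shows "hook_enum b S ` {..b} = insert 1 S" "inj_on (hook_enum b S) {..b}"
proof -
  have b: "{..b} = insert 0 {1..b}" by auto
  have "hook_enum b S ` {1..b} = S" using hook_enum(2)[OF assms] by (rule bij_betw_imp_surj_on)
  moreover have "1 \<notin> S" using assms by (auto simp: hook_index_def)
  ultimately show "hook_enum b S ` {..b} = insert 1 S" "inj_on (hook_enum b S) {..b}"
    using hook_enum[OF assms] unfolding b by (auto simp: bij_betw_def)
qed

lemma ball_hook_enum:
  assumes "S \<in> hook_index n b"
  shows "(\<forall>i\<in>{1..b}. P (hook_enum b S i)) \<longleftrightarrow> (\<forall>s\<in>S. P s)"
  using bij_betw_imp_surj_on[OF hook_enum(2)[OF assms]] by force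

text \<open>A contributing \<open>p\<close> maps \<open>S\<close> onto \<open>S'\<close>, which
  avoids 1; since it permutes \<open>insert 1 S\<close>, this forces \<open>S' = S\<close> and then
  \<open>p = id\<close>. The polytabloids with 1 in the corner are thus dual to the evaluations used
  as coordinates.\<close>

lemma hook_vec_hook_enum:
  assumes "S \<in> hook_index n b" "S' \<in> hook_index n b"
  shows "hook_vec n b (hook_enum b S) (row_tabloid n b (hook_enum b S')) = (if S = S' then 1 else 0)"
proof -
  let ?P = "{p. p permutes insert 1 S \<and> (\<forall>i\<in>{1..b}. p (hook_enum b S i) = hook_enum b S' i)}"
  have one: "1 \<notin> S" "1 \<notin> S'" and fin: "finite S" "finite S'" and card: "card S = card S'"
    using assms by (auto simp: hook_index_def intro: finite_subset)
  have im: "hook_enum b S ` {1..b} = S" "hook_enum b S' ` {1..b} = S'"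
    using assms hook_enum(2) bij_betw_imp_surj_on by blast+
  have "S = S' \<and> p = id" if "p \<in> ?P" for p
  proof -
    have p: "p permutes insert 1 S" "\<forall>i\<in>{1..b}. p (hook_enum b S i) = hook_enum b S' i"
      using that by auto
    have "S' \<subseteq> S"
    proof
      fix s assume "s \<in> S'"
      then obtain i where i: "i \<in> {1..b}" "s = hook_enum b S' i" using im by blast
      then have "s = p (hook_enum b S i)" using p by simp
      moreover have "hook_enum b S i \<in> S" using i im by blast
      ultimately have "s \<in> insert 1 S" using permutes_in_image[OF p(1)] by auto
      then show "s \<in> S" using \<open>s \<in> S'\<close> one by auto
    qed
    then have S: "S = S'" using card fin by (metis card_subset_eq)
    have pS: "p s = s" if "s \<in> S" for s
      using that im p(2) unfolding S by force
    have "p u = u" for u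
    proof (cases "u = 1")
      case True
      have "p 1 \<in> insert 1 S" using permutes_in_image[OF p(1)] by auto
      moreover have "p 1 \<notin> S"
        using pS one permutes_inj[OF p(1)] by (metis injD)
      ultimately show ?thesis using True by auto
    next
      case False
      then show ?thesis using pS p(1) by (cases "u \<in> S") (auto simp: permutes_def)
    qed
    then show ?thesis using S by auto
  qed
  moreover have "id \<in> ?P" if "S = S'" using that by (auto simp: permutes_id)
  ultimately have "?P = (if S = S' then {id} else {})" by auto
  then show ?thesis
    by (simp add: hook_vec_row_tabloid hook_enum_image[OF assms(1)] del: One_nat_def)
qed

text \<open>Only vanishing is tracked, so the induction over transpositions carries no sign.\<close>

lemma hook_space_vanish_comp:
  assumes "v \<in> hook_space n b" "\<pi> permutes {1..b}" "v (row_tabloid n b y) = 0"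
  shows "v (row_tabloid n b (y \<circ> \<pi>)) = 0"
proof -
  have "finite {1..b}" by simp
  from this assms(2) show ?thesis
  proof (induction rule: permutes_rev_induct)
    case id
    then show ?case using assms(3) by simp
  next
    case (swap i j p)
    then show ?case using hook_spaceD(2)[OF assms(1) swap(1,2,3), of "y \<circ> p"]
      by (simp add: comp_def)
  qed
qed

text \<open>Coning at 1: a sequence avoiding 1 is a reordering of some \<open>hook_enum\<close>; for
  a sequence with 1 in row 1, every other term of the boundary relation avoids 1; and alternation
  brings an entry 1 from any row to row 1.\<close>

lemma hook_space_eq_0:
  assumes v: "v \<in> hook_space n b"
    and 0: "\<And>S. S \<in> hook_index n b \<Longrightarrow> v (row_tabloid n b (hook_enum b S)) = 0"
  shows "v = 0"
proof -
  \<comment> \<open>\<open>hook_space\<close> imposes its relations for all \<open>y\<close>; those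
    with repeated or foreign entries lie outside the support.\<close>
  have not_inj: "v (row_tabloid n b y) = 0" if "\<not> (inj_on y {1..b} \<and> y ` {1..b} \<subseteq> {1..n})" for y
  proof (rule ccontr)
    assume "v (row_tabloid n b y) \<noteq> 0"
    then obtain z where z: "inj_on z {1..b}" "z ` {1..b} \<subseteq> {1..n}"
      "row_tabloid n b y = row_tabloid n b z" using hook_spaceD(1)[OF v] by blast
    then have yz: "\<And>i. i \<in> {1..b} \<Longrightarrow> y i = z i" by (simp add: row_tabloid_eq_iff)
    have "inj_on y {1..b} \<longleftrightarrow> inj_on z {1..b}" using yz by (rule inj_on_cong)
    moreover have "y ` {1..b} = z ` {1..b}" using yz by (rule image_cong[OF refl])
    ultimately show False using that z by blast
  qed
  have no_one: "v (row_tabloid n b y) = 0" if "1 \<notin> y ` {1..b}" for y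
  proof (cases "inj_on y {1..b} \<and> y ` {1..b} \<subseteq> {1..n}")
    case True
    define S where "S = y ` {1..b}"
    have "s \<in> {2..n}" if "s \<in> S" for s
    proof -
      have "s \<in> {1..n}" "s \<noteq> 1"
        using that True \<open>1 \<notin> y ` {1..b}\<close> unfolding S_def by blast+
      then show ?thesis by auto
    qed
    then have S: "S \<in> hook_index n b"
      using True by (auto simp: hook_index_def S_def card_image)
    have bij: "bij_betw (hook_enum b S) {1..b} S" by (rule hook_enum(2)[OF S])
    define \<pi> where "\<pi> i = (if i \<in> {1..b} then inv_into {1..b} (hook_enum b S) (y i) else i)" for i
    have "bij_betw (inv_into {1..b} (hook_enum b S) \<circ> y) {1..b} {1..b}"
      using True bij_betw_inv_into[OF bij] by (intro bij_betw_trans[of _ _ S]) (auto simp: S_def bij_betw_def)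
    then have "bij_betw \<pi> {1..b} {1..b}"
      by (subst bij_betw_cong[of _ _ "inv_into {1..b} (hook_enum b S) \<circ> y"]) (auto simp: \<pi>_def)
    then have "\<pi> permutes {1..b}" by (rule bij_imp_permutes) (auto simp: \<pi>_def)
    then have "v (row_tabloid n b (hook_enum b S \<circ> \<pi>)) = 0"
      using hook_space_vanish_comp[OF v] 0[OF S] by blast
    moreover have "row_tabloid n b (hook_enum b S \<circ> \<pi>) = row_tabloid n b y"
      by (rule row_tabloid_cong)
        (use bij in \<open>auto simp: \<pi>_def S_def bij_betw_def f_inv_into_f\<close>)
    ultimately show ?thesis by simp
  qed (rule not_inj)
  have first: "v (row_tabloid n b y) = 0" if "b \<ge> 1" "y 1 = 1" for y
  proof (cases "inj_on y {1..b} \<and> y ` {1..b} \<subseteq> {1..n}")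
    case True
    have "v (row_tabloid n b (y(1 := c))) = 0" if "c \<in> {1..n} - {1}" for c
    proof (rule no_one)
      have "y i \<noteq> 1" if "i \<in> {1..b}" "i \<noteq> 1" for i
      proof
        assume "y i = 1"
        with \<open>y 1 = 1\<close> have "y i = y 1" by simp
        with True that \<open>b \<ge> 1\<close> show False by (auto dest: inj_onD)
      qed
      then show "1 \<notin> (y(1 := c)) ` {1..b}" using that by (auto simp del: One_nat_def)
    qed
    moreover have one_le: "1 \<in> {1..n}"
    proof -
      have "1 \<in> {1..b}" using \<open>b \<ge> 1\<close> by simp
      then have "y 1 \<in> {1..n}" using True by blast
      then show ?thesis using \<open>y 1 = 1\<close> by simp
    qed
    ultimately have "(\<Sum>c\<in>{1..n}. v (row_tabloid n b (y(1 := c)))) = v (row_tabloid n b (y(1 := 1)))"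
      using one_le by (subst sum.remove[of _ 1]) auto
    then show ?thesis using hook_spaceD(3)[OF v that(1)] that(2) by (metis fun_upd_triv)
  qed (rule not_inj)
  have "v (row_tabloid n b y) = 0" for y
  proof (cases "1 \<in> y ` {1..b}")
    case True
    then obtain i where i: "i \<in> {1..b}" "y i = 1" by auto
    show ?thesis
    proof (cases "i = 1")
      case False
      have "v (row_tabloid n b (y \<circ> transpose i 1)) = 0"
        using i by (intro first) auto
      then show ?thesis using hook_spaceD(2)[OF v i(1) _ False, of y] i by auto
    qed (use i first in auto)
  qed (rule no_one)
  then show ?thesis using hook_spaceD(1)[OF v] by (metis ext zero_fun_apply)
qed

lemma hook_space_expand:
  assumes v: "v \<in> hook_space n b" and n: "n \<ge> 1"
  shows "v = (\<Sum>S\<in>hook_index n b.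
    fscale (v (row_tabloid n b (hook_enum b S))) (hook_vec n b (hook_enum b S)))" (is "v = ?w")
proof -
  have w: "?w \<in> hook_space n b"
  proof (intro fun_space.subspace_sum subspace_hook_space fun_space.subspace_scale
      hook_vec_in_hook_space)
    fix S assume S: "S \<in> hook_index n b"
    show "inj_on (hook_enum b S) {..b}" by (rule hook_enum_image[OF S])
    show "hook_enum b S ` {..b} \<subseteq> {1..n}"
      using S n unfolding hook_enum_image[OF S] by (auto simp: hook_index_def)
  qed
  have "v - ?w = 0"
  proof (rule hook_space_eq_0)
    show "v - ?w \<in> hook_space n b" by (intro fun_space.subspace_diff subspace_hook_space v w)
    fix S assume S: "S \<in> hook_index n b"
    have "?w (row_tabloid n b (hook_enum b S))
      = (\<Sum>S'\<in>hook_index n b. if S' = S then v (row_tabloid n b (hook_enum b S')) else 0)"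
      unfolding sum_fun_apply
      by (rule sum.cong) (auto simp: fscale_def hook_vec_hook_enum S)
    then show "(v - ?w) (row_tabloid n b (hook_enum b S)) = 0" using S by simp
  qed
  then show ?thesis by simp
qed

section \<open>The action of permutations on the hook space\<close>

lemma tabloid_action_row_tabloid:
  assumes "\<sigma> permutes {1..n}"
  shows "tabloid_action \<sigma> v (row_tabloid n b y) = v (row_tabloid n b (perm_inv \<sigma> \<circ> y))"
proof -
  have vim: "\<sigma> -` A = perm_inv \<sigma> ` A" for A
    using permutes_bij[OF assms] by (simp add: bij_vimage_eq_inv_image)
  have "perm_inv \<sigma> ` {1..n} = {1..n}" by (rule permutes_image[OF permutes_inv[OF assms]])
  moreover have "inj (perm_inv \<sigma>)" using permutes_inj[OF permutes_inv[OF assms]] .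
  ultimately have "(\<lambda>i. \<sigma> -` row_tabloid n b y i) = row_tabloid n b (perm_inv \<sigma> \<circ> y)"
    by (auto simp: fun_eq_iff row_tabloid_def vim image_set_diff image_comp)
  then show ?thesis by (simp add: tabloid_action_def)
qed

lemma linear_tabloid_action: "Vector_Spaces.linear fscale fscale (tabloid_action \<sigma>)"
  by unfold_locales (auto simp: tabloid_action_def fscale_def fun_eq_iff)

lemma tabloid_action_hook_space:
  assumes \<sigma>: "\<sigma> permutes {1..n}" and v: "v \<in> hook_space n b"
  shows "tabloid_action \<sigma> v \<in> hook_space n b"
proof (rule hook_spaceI)
  have bij: "bij \<sigma>" by (rule permutes_bij[OF \<sigma>])
  fix U assume "tabloid_action \<sigma> v U \<noteq> 0"
  then obtain y where y: "inj_on y {1..b}" "y ` {1..b} \<subseteq> {1..n}"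
    "(\<lambda>i. \<sigma> -` U i) = row_tabloid n b y"
    using hook_spaceD(1)[OF v] unfolding tabloid_action_def by blast
  have "U i = row_tabloid n b (\<sigma> \<circ> y) i" for i
  proof -
    have "U i = \<sigma> ` (\<sigma> -` U i)" using bij by (simp add: bij_is_surj surj_image_vimage_eq)
    also have "\<dots> = \<sigma> ` row_tabloid n b y i" using y(3) by (metis)
    also have "\<dots> = row_tabloid n b (\<sigma> \<circ> y) i"
      using bij permutes_image[OF \<sigma>]
      by (auto simp: row_tabloid_def image_set_diff bij_is_inj image_comp)
    finally show ?thesis .
  qed
  moreover have "inj_on (\<sigma> \<circ> y) {1..b}"
    using y bij by (intro comp_inj_on) (auto intro: inj_on_subset simp: bij_def)
  moreover have "(\<sigma> \<circ> y) ` {1..b} \<subseteq> {1..n}"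
    using y permutes_in_image[OF \<sigma>] by force
  ultimately show "\<exists>y. inj_on y {1..b} \<and> y ` {1..b} \<subseteq> {1..n} \<and> U = row_tabloid n b y"
    by blast
next
  fix y i j assume "i \<in> {1..b}" "j \<in> {1..b}" "i \<noteq> j"
  then show "tabloid_action \<sigma> v (row_tabloid n b (y \<circ> transpose i j))
      = - tabloid_action \<sigma> v (row_tabloid n b y)"
    using hook_spaceD(2)[OF v, of i j "perm_inv \<sigma> \<circ> y"]
    by (simp add: tabloid_action_row_tabloid[OF \<sigma>] comp_assoc)
next
  fix y assume b: "b \<ge> 1"
  have "(\<Sum>c\<in>{1..n}. tabloid_action \<sigma> v (row_tabloid n b (y(1 := c))))
      = (\<Sum>c\<in>{1..n}. v (row_tabloid n b ((perm_inv \<sigma> \<circ> y)(1 := perm_inv \<sigma> c))))"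
    by (simp add: tabloid_action_row_tabloid[OF \<sigma>] fun_upd_comp)
  also have "\<dots> = (\<Sum>c\<in>{1..n}. v (row_tabloid n b ((perm_inv \<sigma> \<circ> y)(1 := c))))"
    using sum.permute[OF permutes_inv[OF \<sigma>],
        of "\<lambda>c. v (row_tabloid n b ((perm_inv \<sigma> \<circ> y)(1 := c)))"] by (simp add: comp_def)
  also have "\<dots> = 0" by (rule hook_spaceD(3)[OF v b])
  finally show "(\<Sum>c\<in>{1..n}. tabloid_action \<sigma> v (row_tabloid n b (y(1 := c)))) = 0" .
qed

section \<open>Tableaux and polytabloids of hook shape\<close>

lemma diagram_hook: "diagram (hook (a, b)) = {(i, j). i = 0 \<and> j \<le> a \<or> j = 0 \<and> i \<le> b}"
proof -
  have "((a + 1) # replicate b 1) ! i = (if i = 0 then a + 1 else 1)" if "i < b + 1" for i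
    using that by (cases i) auto
  then show ?thesis by (auto simp: diagram_def hook_def split: if_splits)
qed

lemma sum_list_hook [simp]: "sum_list (hook (a, b)) = a + b + 1"
  by (simp add: hook_def sum_list_replicate)

text \<open>Every column but the first is empty or a single cell, so the column group consists of
  all permutations of the first-column entries.\<close>

lemma polytabloid_hook:
  assumes t: "is_tableau (hook (a, b)) t" and n: "n = a + b + 1"
  defines "x \<equiv> \<lambda>i. t (i, 0)"
  shows "inj_on x {..b}" "x ` {..b} \<subseteq> {1..n}" "polytabloid (hook (a, b)) t = hook_vec n b x"
proof -
  let ?D = "{(i, j). i = 0 \<and> j \<le> a \<or> j = 0 \<and> i \<le> b} :: (nat \<times> nat) set"
  have bij: "bij_betw t ?D {1..n}"
    using t n by (simp add: is_tableau_def diagram_hook)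
  then have inj: "inj_on t ?D" and im: "t ` ?D = {1..n}" by (auto simp: bij_betw_def)
  show injx: "inj_on x {..b}"
    by (rule inj_onI) (use inj in \<open>auto simp: x_def dest!: inj_onD\<close>)
  show xn: "x ` {..b} \<subseteq> {1..n}" using im by (auto simp: x_def)
  have col: "t ` {c \<in> ?D. snd c = j} = (if j = 0 then x ` {..b} else if j \<le> a then {t (0, j)} else {})"
    for j
  proof -
    have "{c \<in> ?D. snd c = j} = (if j = 0 then (\<lambda>i. (i, 0)) ` {..b} else if j \<le> a then {(0, j)} else {})"
      by auto
    then show ?thesis by (auto simp: x_def)
  qed
  have row0: "t ` {c \<in> ?D. fst c = 0} = {1..n} - x ` {1..b}"
  proof -
    have "{c \<in> ?D. fst c = 0} = ?D - (\<lambda>i. (i, 0)) ` {1..b}" by auto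
    moreover have "t ` (?D - (\<lambda>i. (i, 0)) ` {1..b}) = t ` ?D - t ` (\<lambda>i. (i, 0)) ` {1..b}"
      by (rule inj_on_image_set_diff[OF inj]) auto
    ultimately show ?thesis using im by (auto simp: x_def image_comp)
  qed
  have row: "t ` {c \<in> ?D. fst c = i} = (if i \<le> b then {x i} else {})" if "i \<noteq> 0" for i
  proof -
    have "{c \<in> ?D. fst c = i} = (if i \<le> b then {(i, 0)} else {})" using that by auto
    then show ?thesis by (auto simp: x_def)
  qed
  have off: "t (0, j) \<notin> x ` {..b}" if "j \<noteq> 0" "j \<le> a" for j
  proof
    assume "t (0, j) \<in> x ` {..b}"
    then obtain i where "i \<le> b" "t (0, j) = t (i, 0)" by (auto simp: x_def)
    then have "(0, j) = (i, 0)" using that by (intro inj_onD[OF inj]) auto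
    then show False using that by simp
  qed
  have cg: "column_group (hook (a, b)) t = {p. p permutes x ` {..b}}"
  proof (rule Set.set_eqI, rule iffI)
    fix p assume "p \<in> column_group (hook (a, b)) t"
    then have p: "p permutes {1..n}"
      and cols: "\<And>j. p ` t ` {c \<in> ?D. snd c = j} = t ` {c \<in> ?D. snd c = j}"
      by (auto simp: column_group_def n diagram_hook)
    have "p u = u" if "u \<in> {1..n} - x ` {..b}" for u
    proof -
      have "u \<in> t ` ?D" using that im by auto
      then obtain i j where ij: "(i, j) \<in> ?D" "u = t (i, j)" by auto
      moreover have "j \<noteq> 0"
      proof
        assume "j = 0"
        then have "u \<in> x ` {..b}" using ij by (auto simp: x_def)
        then show False using that by simp
      qed
      ultimately have "i = 0" "j \<le> a" by auto
      then show ?thesis using cols[of j] \<open>j \<noteq> 0\<close> ij unfolding col by simp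
    qed
    then show "p \<in> {p. p permutes x ` {..b}}"
      using permutes_superset[OF p] by auto
  next
    fix p assume "p \<in> {p. p permutes x ` {..b}}"
    then have p: "p permutes x ` {..b}" by simp
    then have pn: "p permutes {1..n}" using xn by (rule permutes_subset)
    have "p ` t ` {c \<in> ?D. snd c = j} = t ` {c \<in> ?D. snd c = j}" for j
      unfolding col using permutes_image[OF p] off[of j] permutes_not_in[OF p] by auto
    then show "p \<in> column_group (hook (a, b)) t"
      using pn by (simp add: column_group_def n diagram_hook)
  qed
  have tab: "tabloid_of (hook (a, b)) (p \<circ> t) = row_tabloid n b (p \<circ> x)"
    if "p permutes x ` {..b}" for p
  proof
    fix i
    have pn: "p permutes {1..n}" using that xn by (rule permutes_subset)
    have "tabloid_of (hook (a, b)) (p \<circ> t) i = p ` t ` {c \<in> ?D. fst c = i}"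
      by (simp add: tabloid_of_def diagram_hook image_comp)
    also have "\<dots> = row_tabloid n b (p \<circ> x) i"
    proof (cases "i = 0")
      case True
      then show ?thesis
        unfolding row0 True
        using permutes_image[OF pn] permutes_inj[OF pn]
        by (simp add: row_tabloid_def image_set_diff image_comp)
    next
      case False
      then show ?thesis unfolding row[OF False] by (simp add: row_tabloid_def)
    qed
    finally show "tabloid_of (hook (a, b)) (p \<circ> t) i = row_tabloid n b (p \<circ> x) i" .
  qed
  show "polytabloid (hook (a, b)) t = hook_vec n b x"
    unfolding polytabloid_def hook_vec_def cg by (rule sum.cong) (auto simp: tab)
qed

lemma hook_tableau_extension:
  assumes x: "inj_on x {..b}" "x ` {..b} \<subseteq> {1..a + b + 1}"
  obtains t where "is_tableau (hook (a, b)) t" "(\<lambda>i. t (i, 0)) = x"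
proof -
  have "card ({1..a + b + 1} - x ` {..b}) = a"
    using x by (subst card_Diff_subset) (auto simp: card_image)
  then have "card {1..a} = card ({1..a + b + 1} - x ` {..b})" by simp
  then obtain g where g: "bij_betw g {1..a} ({1..a + b + 1} - x ` {..b})"
    by (metis finite_atLeastAtMost finite_Diff finite_same_card_bij)
  define t where "t = (\<lambda>(i::nat, j::nat). if j = 0 then x i else g j)"
  have "bij_betw t ((\<lambda>i. (i, 0)) ` {..b} \<union> Pair 0 ` {1..a})
      (x ` {..b} \<union> ({1..a + b + 1} - x ` {..b}))"
  proof (rule bij_betw_combine)
    show "bij_betw t ((\<lambda>i. (i, 0)) ` {..b}) (x ` {..b})"
      using x(1) by (simp add: bij_betw_def t_def inj_on_def image_image)
    have "t ` Pair 0 ` {1..a} = g ` {1..a}" by (simp add: t_def image_image)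
    moreover have "inj_on (t \<circ> Pair 0) {1..a} \<longleftrightarrow> inj_on g {1..a}"
      by (rule inj_on_cong) (auto simp: t_def)
    then have "inj_on t (Pair 0 ` {1..a})"
      using bij_betw_imp_inj_on[OF g] by (intro inj_on_imageI) simp
    ultimately show "bij_betw t (Pair 0 ` {1..a}) ({1..a + b + 1} - x ` {..b})"
      using bij_betw_imp_surj_on[OF g] by (simp add: bij_betw_def)
  qed auto
  moreover have "(\<lambda>i. (i, 0)) ` {..b} \<union> Pair 0 ` {1..a} = diagram (hook (a, b))"
    by (auto simp: diagram_hook image_iff)
  moreover have "x ` {..b} \<union> ({1..a + b + 1} - x ` {..b}) = {1..a + b + 1}"
    using x by auto
  ultimately have "is_tableau (hook (a, b)) t" by (simp add: is_tableau_def)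
  then show ?thesis by (rule that) (simp add: t_def)
qed

text \<open>Each generator satisfies the linear conditions; conversely
  \<open>hook_space_expand\<close> writes any solution in terms of polytabloids with 1 in the
  corner.\<close>

lemma specht_hook:
  assumes n: "n = a + b + 1"
  shows "specht (hook (a, b)) = hook_space n b"
proof -
  have gen: "{polytabloid (hook (a, b)) t | t. is_tableau (hook (a, b)) t}
      = {hook_vec n b x | x. inj_on x {..b} \<and> x ` {..b} \<subseteq> {1..n}}"
  proof (rule Set.set_eqI, rule iffI)
    fix v assume "v \<in> {hook_vec n b x | x. inj_on x {..b} \<and> x ` {..b} \<subseteq> {1..n}}"
    then obtain x where x: "inj_on x {..b}" "x ` {..b} \<subseteq> {1..n}" "v = hook_vec n b x" by auto
    from x(1) x(2)[unfolded n] obtain t where "is_tableau (hook (a, b)) t" "(\<lambda>i. t (i, 0)) = x"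
      by (rule hook_tableau_extension)
    then have "v = polytabloid (hook (a, b)) t" using polytabloid_hook(3)[OF _ n] x(3) by simp
    then show "v \<in> {polytabloid (hook (a, b)) t | t. is_tableau (hook (a, b)) t}"
      using \<open>is_tableau (hook (a, b)) t\<close> by blast
  qed (use polytabloid_hook[OF _ n] in blast)
  show ?thesis
  proof
    show "specht (hook (a, b)) \<subseteq> hook_space n b"
      unfolding specht_def gen
      by (rule fun_space.span_minimal[OF _ subspace_hook_space]) (use hook_vec_in_hook_space in blast)
    show "hook_space n b \<subseteq> specht (hook (a, b))"
    proof
      fix v assume v: "v \<in> hook_space n b"
      have "hook_vec n b (hook_enum b S) \<in> specht (hook (a, b))" if "S \<in> hook_index n b" for S
      proof -
        have "hook_enum b S ` {..b} \<subseteq> {1..n}"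
          using that n unfolding hook_enum_image[OF that] by (auto simp: hook_index_def)
        then show ?thesis
          unfolding specht_def gen using hook_enum_image(2)[OF that]
          by (intro fun_space.span_base CollectI exI[of _ "hook_enum b S"] conjI refl)
      qed
      then show "v \<in> specht (hook (a, b))"
        by (subst hook_space_expand[OF v])
          (auto simp: n specht_def intro!: fun_space.span_sum fun_space.span_scale)
    qed
  qed
qed

text \<open>The sum of the diagonal entries in the basis indexed by \<open>S\<close>. At most one
  \<open>p\<close> occurs for each \<open>S\<close>: its values on \<open>S\<close> are prescribed
  by \<open>\<tau>\<close>, and 1 receives the value that is left.\<close>

definition hook_char :: "nat \<Rightarrow> nat \<Rightarrow> (nat \<Rightarrow> nat) \<Rightarrow> int" where
  "hook_char n b \<tau> = (\<Sum>S\<in>hook_index n b.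
     \<Sum>p | p permutes insert 1 S \<and> (\<forall>s\<in>S. p s = \<tau> s). sign p)"

text \<open>A diagonal entry evaluates the moved vector at a tabloid, which pulls the tabloid back
  along \<open>\<sigma>\<close>; this is where the inverse comes from.\<close>

theorem sym_char_hook:
  assumes n: "n = a + b + 1" and \<sigma>: "\<sigma> permutes {1..n}"
  shows "sym_char (hook (a, b)) \<sigma> = of_int (hook_char n b (perm_inv \<sigma>))"
proof -
  have "sym_char (hook (a, b)) \<sigma> = (\<Sum>S\<in>hook_index n b.
      tabloid_action \<sigma> (hook_vec n b (hook_enum b S)) (row_tabloid n b (hook_enum b S)))"
    unfolding sym_char_def specht_hook[OF n]
  proof (rule trace_on_eq_sum[OF finite_hook_index subspace_hook_space _ linear_tabloid_action])
    fix S assume S: "S \<in> hook_index n b"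
    show "hook_vec n b (hook_enum b S) \<in> hook_space n b"
      using S n by (intro hook_vec_in_hook_space hook_enum_image[OF S])
        (auto simp: hook_enum_image[OF S] hook_index_def simp del: One_nat_def)
  qed (use n tabloid_action_hook_space[OF \<sigma>] hook_space_expand in auto)
  also have "\<dots> = (\<Sum>S\<in>hook_index n b.
      \<Sum>p | p permutes insert 1 S \<and> (\<forall>s\<in>S. p s = perm_inv \<sigma> s). of_int (sign p))"
    by (rule sum.cong, rule refl)
      (simp add: tabloid_action_row_tabloid[OF \<sigma>] hook_vec_row_tabloid hook_enum_image
        ball_hook_enum[where P = "\<lambda>s. _ s = _ s"] del: One_nat_def)
  finally show ?thesis by (simp add: hook_char_def)
qed

section \<open>Exterior powers of the permutation representation\<close>

text \<open>
  The coefficient of \<open>X\<^sup>b\<close> is the character of the \<open>b\<close>-th exterior power of the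
  permutation representation on \<open>A\<close>, that is, the series is \<open>det (1 + X \<tau>)\<close>.
\<close>

definition ext_fps :: "nat set \<Rightarrow> (nat \<Rightarrow> nat) \<Rightarrow> int fps" where
  "ext_fps A \<tau> = (\<Sum>X | X \<subseteq> A \<and> \<tau> ` X = X.
     fps_const (sign (perm_restrict \<tau> X)) * fps_X ^ card X)"

lemma perm_restrict_permutes:
  assumes "finite X" "\<tau> ` X = X"
  shows "perm_restrict \<tau> X permutes X"
proof (rule bij_imp_permutes)
  have "inj_on \<tau> X" using assms by (simp add: eq_card_imp_inj_on)
  then have "bij_betw \<tau> X X" using assms by (simp add: bij_betw_def)
  then show "bij_betw (perm_restrict \<tau> X) X X"
    by (subst bij_betw_cong[of _ _ \<tau>]) (auto simp: perm_restrict_simps)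
qed (simp add: perm_restrict_simps)

lemma ext_fps_nth:
  assumes "finite A"
  shows "fps_nth (ext_fps A \<tau>) b
    = (\<Sum>X | X \<subseteq> A \<and> \<tau> ` X = X \<and> card X = b. sign (perm_restrict \<tau> X))"
proof -
  have "fps_nth (ext_fps A \<tau>) b
      = (\<Sum>X | X \<subseteq> A \<and> \<tau> ` X = X. if card X = b then sign (perm_restrict \<tau> X) else 0)"
    by (auto simp: ext_fps_def fps_sum_nth fps_X_power_iff intro!: sum.cong)
  also have "\<dots> = (\<Sum>X | X \<subseteq> A \<and> \<tau> ` X = X \<and> card X = b. sign (perm_restrict \<tau> X))"
    using assms by (subst sum.inter_filter[symmetric]) (auto simp: conj_assoc)
  finally show ?thesis .
qed

text \<open>The intertwining relation is required on \<open>A\<close> alone. One statement thus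
  covers conjugation in the symmetric group, moving one half of the points to the other, and, with
  \<open>h = id\<close>, changing the map outside \<open>A\<close>.\<close>

lemma ext_fps_conj:
  assumes fin: "finite A" and h: "permutation h"
    and eq: "\<And>x. x \<in> A \<Longrightarrow> \<sigma> (h x) = h (\<tau> x)"
  shows "ext_fps (h ` A) \<sigma> = ext_fps A \<tau>"
proof -
  have bij: "bij h" using h by (rule permutation_bijective)
  have inj: "inj h" using bij by (rule bij_is_inj)
  have img: "\<sigma> ` h ` X = h ` \<tau> ` X" if "X \<subseteq> A" for X
    using that eq by (force simp: image_image)
  have sg: "sign (perm_restrict \<sigma> (h ` X)) = sign (perm_restrict \<tau> X)"
    if X: "X \<subseteq> A" "\<tau> ` X = X" for X
  proof -
    have "perm_restrict \<tau> X permutes X"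
      using X finite_subset[OF _ fin] by (intro perm_restrict_permutes) auto
    then have p: "permutation (perm_restrict \<tau> X)"
      using X finite_subset[OF _ fin] by (metis permutes_imp_permutation)
    have "perm_restrict \<sigma> (h ` X) \<circ> h = h \<circ> perm_restrict \<tau> X"
      using X eq inj by (auto simp: fun_eq_iff perm_restrict_def inj_image_mem_iff)
    then have "perm_restrict \<sigma> (h ` X) = h \<circ> perm_restrict \<tau> X \<circ> perm_inv h"
      using bij by (metis bij_is_surj comp_assoc comp_id surj_iff)
    then show ?thesis
      using p h by (simp add: sign_compose permutation_compose permutation_inverse sign_inverse)
  qed
  have X: "X \<in> {X. X \<subseteq> A \<and> \<tau> ` X = X} \<longleftrightarrow> X \<subseteq> A \<and> \<sigma> ` h ` X = h ` X" for X
  proof -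
    have "\<sigma> ` h ` X = h ` X \<longleftrightarrow> \<tau> ` X = X" if "X \<subseteq> A"
      using img[OF that] inj by (simp add: inj_image_eq_iff)
    then show ?thesis by blast
  qed
  show ?thesis
    unfolding ext_fps_def
  proof (rule sum.reindex_bij_witness[of _ "\<lambda>X. h ` X" "\<lambda>X. h -` X"])
    fix Y assume Y: "Y \<in> {X. X \<subseteq> h ` A \<and> \<sigma> ` X = X}"
    show 1: "h ` h -` Y = Y" using bij by (simp add: bij_is_surj surj_image_vimage_eq)
    have "h -` Y \<subseteq> A" using Y inj_image_mem_iff[OF inj] by blast
    then show 2: "h -` Y \<in> {X. X \<subseteq> A \<and> \<tau> ` X = X}" using Y unfolding X 1 by simp
    have "card (h -` Y) = card Y" using 1 inj by (metis card_image inj_on_subset subset_UNIV)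
    then show "fps_const (sign (perm_restrict \<tau> (h -` Y))) * fps_X ^ card (h -` Y)
      = fps_const (sign (perm_restrict \<sigma> Y)) * fps_X ^ card Y"
      using sg[of "h -` Y"] 2 1 by simp
  next
    fix Y assume "Y \<in> {X. X \<subseteq> A \<and> \<tau> ` X = X}"
    then show "h ` Y \<in> {X. X \<subseteq> h ` A \<and> \<sigma> ` X = X}" "h -` h ` Y = Y"
      using img inj by (auto simp: inj_vimage_image_eq)
  qed
qed

lemma ext_fps_cong:
  assumes "finite A" "\<And>x. x \<in> A \<Longrightarrow> \<sigma> x = \<tau> x"
  shows "ext_fps A \<sigma> = ext_fps A \<tau>"
  using ext_fps_conj[of A id \<sigma> \<tau>] assms by (simp add: permutation_id)

text \<open>The determinant of a block diagonal matrix: an invariant subset of the union is a pair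
  of invariant subsets of the blocks, signs multiply and sizes add.\<close>

lemma ext_fps_Un:
  assumes fin: "finite A" "finite B" and disj: "A \<inter> B = {}"
    and inv: "\<tau> ` A \<subseteq> A" "\<tau> ` B \<subseteq> B"
  shows "ext_fps (A \<union> B) \<tau> = ext_fps A \<tau> * ext_fps B \<tau>"
proof -
  let ?I = "\<lambda>A. {X. X \<subseteq> A \<and> \<tau> ` X = X}"
  let ?f = "\<lambda>X. fps_const (sign (perm_restrict \<tau> X)) * fps_X ^ card X :: int fps"
  have split: "\<tau> ` (X \<inter> A) = X \<inter> A" "\<tau> ` (X \<inter> B) = X \<inter> B"
    if "X \<subseteq> A \<union> B" "\<tau> ` X = X" for X
  proof -
    have "\<tau> ` (X \<inter> A) \<subseteq> X \<inter> A" "\<tau> ` (X \<inter> B) \<subseteq> X \<inter> B" using inv that by auto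
    moreover have "X \<inter> A \<subseteq> \<tau> ` (X \<inter> A)"
    proof
      fix y assume y: "y \<in> X \<inter> A"
      then have "y \<in> \<tau> ` X" using that by simp
      then obtain x where x: "x \<in> X" "y = \<tau> x" by auto
      then have "x \<in> A" using y that(1) inv disj by blast
      then show "y \<in> \<tau> ` (X \<inter> A)" using x by blast
    qed
    moreover have "X \<inter> B \<subseteq> \<tau> ` (X \<inter> B)"
    proof
      fix y assume y: "y \<in> X \<inter> B"
      then have "y \<in> \<tau> ` X" using that by simp
      then obtain x where x: "x \<in> X" "y = \<tau> x" by auto
      then have "x \<in> B" using y that(1) inv disj by blast
      then show "y \<in> \<tau> ` (X \<inter> B)" using x by blast
    qed
    ultimately show "\<tau> ` (X \<inter> A) = X \<inter> A" "\<tau> ` (X \<inter> B) = X \<inter> B" by auto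
  qed
  have mult: "?f (X \<union> Y) = ?f X * ?f Y" if "X \<in> ?I A" "Y \<in> ?I B" for X Y
  proof -
    have fin': "finite X" "finite Y" using that fin by (auto intro: finite_subset)
    have dXY: "X \<inter> Y = {}" using that disj by auto
    have p: "perm_restrict \<tau> X permutes X" "perm_restrict \<tau> Y permutes Y"
      using that fin' by (auto intro: perm_restrict_permutes)
    have "perm_restrict \<tau> (X \<union> Y) = perm_restrict \<tau> X \<circ> perm_restrict \<tau> Y"
      using perm_restrict_union[OF p dXY] by simp
    then have "sign (perm_restrict \<tau> (X \<union> Y)) = sign (perm_restrict \<tau> X) * sign (perm_restrict \<tau> Y)"
      using p fin' by (metis sign_compose permutes_imp_permutation)
    moreover have "card (X \<union> Y) = card X + card Y" using fin' dXY by (rule card_Un_disjoint)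
    ultimately show ?thesis by (simp add: power_add fps_const_mult[symmetric] del: fps_const_mult)
  qed
  have "ext_fps A \<tau> * ext_fps B \<tau> = (\<Sum>(X, Y)\<in>?I A \<times> ?I B. ?f X * ?f Y)"
    by (simp add: ext_fps_def sum_product sum.cartesian_product)
  also have "\<dots> = (\<Sum>X\<in>?I (A \<union> B). ?f X)"
  proof (rule sum.reindex_bij_witness[of _ "\<lambda>X. (X \<inter> A, X \<inter> B)" "\<lambda>(X, Y). X \<union> Y"])
    fix X assume "X \<in> ?I (A \<union> B)"
    then show "(X \<inter> A, X \<inter> B) \<in> ?I A \<times> ?I B" "(case (X \<inter> A, X \<inter> B) of (X, Y) \<Rightarrow> X \<union> Y) = X"
      using split[of X] by auto
  next
    fix q assume q: "q \<in> ?I A \<times> ?I B"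
    then show "((case q of (X, Y) \<Rightarrow> X \<union> Y) \<inter> A, (case q of (X, Y) \<Rightarrow> X \<union> Y) \<inter> B) = q"
      "(case q of (X, Y) \<Rightarrow> X \<union> Y) \<in> ?I (A \<union> B)"
      "?f (case q of (X, Y) \<Rightarrow> X \<union> Y) = (case q of (X, Y) \<Rightarrow> ?f X * ?f Y)"
      using disj mult by (auto simp: image_Un)
  qed
  finally show ?thesis by (simp add: ext_fps_def)
qed

section \<open>Division of the determinant by \<open>1 + X\<close>\<close>

definition hook_fps :: "nat \<Rightarrow> (nat \<Rightarrow> nat) \<Rightarrow> int fps" where
  "hook_fps n \<tau> = Abs_fps (\<lambda>b. hook_char n b \<tau>)"

lemma hook_fps_nth [simp]: "fps_nth (hook_fps n \<tau>) b = hook_char n b \<tau>"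
  by (simp add: hook_fps_def)

text \<open>
  \<open>p\<close> agrees with \<open>\<tau>\<close> on \<open>S\<close> but may send the root 1 elsewhere than
  \<open>\<tau>\<close> does, closing up a segment of the cycle of \<open>\<tau>\<close> through 1.
\<close>

definition rooted_perms :: "nat \<Rightarrow> nat \<Rightarrow> (nat \<Rightarrow> nat) \<Rightarrow> (nat set \<times> (nat \<Rightarrow> nat)) set" where
  "rooted_perms n b \<tau> = (SIGMA S:hook_index n b. {p. p permutes insert 1 S \<and> (\<forall>s\<in>S. p s = \<tau> s)})"

lemma hook_index_finite: "S \<in> hook_index n b \<Longrightarrow> finite S"
  by (auto simp: hook_index_def intro: finite_subset)

lemma finite_rooted_perms: "finite (rooted_perms n b \<tau>)"
proof -
  have "finite {p. p permutes insert 1 S \<and> (\<forall>s\<in>S. p s = \<tau> s)}" if "S \<in> hook_index n b" for S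
    using finite_permutations[of "insert 1 S"] hook_index_finite[OF that] by simp
  then show ?thesis unfolding rooted_perms_def by (intro finite_SigmaI) auto
qed

lemma hook_char_rooted_perms: "hook_char n b \<tau> = (\<Sum>q\<in>rooted_perms n b \<tau>. sign (snd q))"
proof -
  have "finite {p. p permutes insert 1 S \<and> (\<forall>s\<in>S. p s = \<tau> s)}" if "S \<in> hook_index n b" for S
    using finite_permutations[of "insert 1 S"] hook_index_finite[OF that] by simp
  then show ?thesis unfolding rooted_perms_def hook_char_def by (subst sum.Sigma) (auto simp: case_prod_unfold)
qed

text \<open>If \<open>p\<close> fixes the root, then \<open>S\<close> itself is invariant under
  \<open>\<tau>\<close>, and \<open>p\<close> is the restriction of \<open>\<tau>\<close> to
  \<open>S\<close>.\<close>

lemma sum_rooted_perms_fixing_root: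
  "(\<Sum>q | q \<in> rooted_perms n b \<tau> \<and> snd q 1 = 1. sign (snd q))
    = (\<Sum>X | X \<subseteq> {2..n} \<and> \<tau> ` X = X \<and> card X = b. sign (perm_restrict \<tau> X))"
proof (rule sum.reindex_bij_witness[of _ "\<lambda>X. (X, perm_restrict \<tau> X)" fst])
  fix X assume X: "X \<in> {X. X \<subseteq> {2..n} \<and> \<tau> ` X = X \<and> card X = b}"
  then have "finite X" by (auto intro: finite_subset)
  then have "perm_restrict \<tau> X permutes X" using X by (intro perm_restrict_permutes) auto
  then have "perm_restrict \<tau> X permutes insert 1 X" by (rule permutes_subset) auto
  then show "(X, perm_restrict \<tau> X) \<in> {q. q \<in> rooted_perms n b \<tau> \<and> snd q 1 = 1}"
    using X by (auto simp: rooted_perms_def hook_index_def perm_restrict_def)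
  show "fst (X, perm_restrict \<tau> X) = X" by simp
next
  fix q assume "q \<in> {q. q \<in> rooted_perms n b \<tau> \<and> snd q 1 = 1}"
  then obtain S p where q: "q = (S, p)" and S: "S \<in> hook_index n b"
    and p: "p permutes insert 1 S" "\<forall>s\<in>S. p s = \<tau> s" "p 1 = 1"
    by (auto simp: rooted_perms_def)
  have "p permutes S" using p by (intro permutes_superset[OF p(1)]) auto
  then have "p ` S = S" by (rule permutes_image)
  then have "\<tau> ` S = S" using p(2) by force
  moreover have "perm_restrict \<tau> S = p"
    using p \<open>p permutes S\<close> by (auto simp: fun_eq_iff perm_restrict_def permutes_def)
  ultimately show "(fst q, perm_restrict \<tau> (fst q)) = q"
    "fst q \<in> {X. X \<subseteq> {2..n} \<and> \<tau> ` X = X \<and> card X = b}"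
    "sign (perm_restrict \<tau> (fst q)) = sign (snd q)"
    using S by (auto simp: q hook_index_def)
qed

text \<open>If \<open>p\<close> agrees with \<open>\<tau>\<close> at the root too, it is
  \<open>insert 1 S\<close> that is invariant; this raises the size to \<open>Suc b\<close>.\<close>

lemma sum_rooted_perms_invariant:
  assumes "n \<ge> 1"
  shows "(\<Sum>q | q \<in> rooted_perms n b \<tau> \<and> snd q 1 = \<tau> 1. sign (snd q))
    = (\<Sum>X | X \<subseteq> {1..n} \<and> 1 \<in> X \<and> \<tau> ` X = X \<and> card X = Suc b. sign (perm_restrict \<tau> X))"
proof (rule sum.reindex_bij_witness[of _ "\<lambda>X. (X - {1}, perm_restrict \<tau> X)" "\<lambda>(S, p). insert 1 S"])
  fix X assume X: "X \<in> {X. X \<subseteq> {1..n} \<and> 1 \<in> X \<and> \<tau> ` X = X \<and> card X = Suc b}"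
  then have fin: "finite X" by (auto intro: finite_subset)
  have ins: "insert 1 (X - {1}) = X" using X by auto
  have "perm_restrict \<tau> X permutes X" using X fin by (intro perm_restrict_permutes) auto
  moreover have "X - {1} \<in> hook_index n b"
    using X fin by (auto simp: hook_index_def)
  ultimately show "(X - {1}, perm_restrict \<tau> X) \<in> {q. q \<in> rooted_perms n b \<tau> \<and> snd q 1 = \<tau> 1}"
    using X unfolding rooted_perms_def by (auto simp: ins perm_restrict_def insert_absorb)
  show "(case (X - {1}, perm_restrict \<tau> X) of (S, p) \<Rightarrow> insert 1 S) = X" using ins by simp
next
  fix q assume "q \<in> {q. q \<in> rooted_perms n b \<tau> \<and> snd q 1 = \<tau> 1}"
  then obtain S p where q: "q = (S, p)" and S: "S \<in> hook_index n b"
    and p: "p permutes insert 1 S" "\<forall>s\<in>insert 1 S. p s = \<tau> s"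
    by (auto simp: rooted_perms_def)
  have "p ` insert 1 S = insert 1 S" using p(1) by (rule permutes_image)
  moreover have "p ` insert 1 S = \<tau> ` insert 1 S" using p(2) by (intro image_cong) auto
  ultimately have im: "\<tau> ` insert 1 S = insert 1 S" by (rule trans[OF sym, rotated])
  have pr: "perm_restrict \<tau> (insert 1 S) = p"
    using p(2) permutes_not_in[OF p(1)] by (auto simp: fun_eq_iff perm_restrict_def)
  have one: "1 \<notin> S" using S by (auto simp: hook_index_def)
  then have card: "card (insert 1 S) = Suc b"
    using S hook_index_finite[OF S] by (auto simp: hook_index_def)
  have sub: "insert 1 S \<subseteq> {1..n}" using S assms by (auto simp: hook_index_def)
  show "((case q of (S, p) \<Rightarrow> insert 1 S) - {1}, perm_restrict \<tau> (case q of (S, p) \<Rightarrow> insert 1 S)) = q"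
    "(case q of (S, p) \<Rightarrow> insert 1 S) \<in> {X. X \<subseteq> {1..n} \<and> 1 \<in> X \<and> \<tau> ` X = X \<and> card X = Suc b}"
    "sign (perm_restrict \<tau> (case q of (S, p) \<Rightarrow> insert 1 S)) = sign (snd q)"
    using im pr one card sub unfolding q by auto
qed

text \<open>The bijection removes the last point \<open>p 1\<close> from the cycle of \<open>p\<close> through 1.\<close>

lemma sum_rooted_perms_cancel:
  assumes \<tau>: "\<tau> permutes {1..n}"
  shows "(\<Sum>q | q \<in> rooted_perms n (Suc b) \<tau> \<and> snd q 1 \<noteq> 1. sign (snd q))
    = (\<Sum>q | q \<in> rooted_perms n b \<tau> \<and> snd q 1 \<noteq> \<tau> 1. - sign (snd q))"
proof (rule sum.reindex_bij_witness[of _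
      "\<lambda>(S, p). let w = perm_inv \<tau> (p 1) in (insert w S, p \<circ> transpose 1 w)"
      "\<lambda>(S, p). (S - {p 1}, p \<circ> transpose 1 (p 1))"])
  fix q assume "q \<in> {q. q \<in> rooted_perms n (Suc b) \<tau> \<and> snd q 1 \<noteq> 1}"
  then obtain S p where q: "q = (S, p)" and S: "S \<in> hook_index n (Suc b)"
    and p: "p permutes insert 1 S" "\<forall>s\<in>S. p s = \<tau> s" "p 1 \<noteq> 1"
    by (auto simp: rooted_perms_def)
  define w where "w = p 1"
  have fin: "finite S" by (rule hook_index_finite[OF S])
  have w: "w \<in> S" "w \<noteq> 1" using permutes_in_image[OF p(1), of 1] p(3) by (auto simp: w_def)
  define p' where "p' = p \<circ> transpose 1 w"
  have p'': "p' permutes insert 1 S"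
    unfolding p'_def using w by (intro permutes_compose[OF _ p(1)] permutes_swap_id) auto
  have "p' permutes insert 1 (S - {w})"
    by (rule permutes_superset[OF p'']) (auto simp: p'_def w_def)
  moreover have "p' s = \<tau> s" if "s \<in> S - {w}" for s
  proof -
    have "s \<noteq> 1" using that S by (auto simp: hook_index_def)
    then show ?thesis using that p(2) by (simp add: p'_def)
  qed
  moreover have "S - {w} \<in> hook_index n b"
    using S w fin by (auto simp: hook_index_def)
  ultimately have mem: "(S - {w}, p') \<in> rooted_perms n b \<tau>" by (auto simp: rooted_perms_def)
  have p'1: "p' 1 = \<tau> w" using w p(2) by (simp add: p'_def)
  then have ne: "p' 1 \<noteq> \<tau> 1" using w permutes_inj[OF \<tau>] by (auto simp: inj_eq)
  have inv: "perm_inv \<tau> (p' 1) = w" using p'1 permutes_inverses(2)[OF \<tau>] by simp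
  show "(case q of (S, p) \<Rightarrow> (S - {p 1}, p \<circ> transpose 1 (p 1)))
      \<in> {q. q \<in> rooted_perms n b \<tau> \<and> snd q 1 \<noteq> \<tau> 1}"
    using mem ne by (simp add: q p'_def w_def)
  show "(case (case q of (S, p) \<Rightarrow> (S - {p 1}, p \<circ> transpose 1 (p 1))) of
      (S, p) \<Rightarrow> let w = perm_inv \<tau> (p 1) in (insert w S, p \<circ> transpose 1 w)) = q"
    using inv w unfolding q by (simp add: p'_def[symmetric] w_def[symmetric] insert_absorb del: One_nat_def)
      (simp add: p'_def comp_assoc)
  show "- sign (snd (case q of (S, p) \<Rightarrow> (S - {p 1}, p \<circ> transpose 1 (p 1))))
      = sign (snd q)"
    using p fin by (simp add: q sign_comp_transpose[of "insert 1 S"])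
next
  fix q assume "q \<in> {q. q \<in> rooted_perms n b \<tau> \<and> snd q 1 \<noteq> \<tau> 1}"
  then obtain S p where q: "q = (S, p)" and S: "S \<in> hook_index n b"
    and p: "p permutes insert 1 S" "\<forall>s\<in>S. p s = \<tau> s" "p 1 \<noteq> \<tau> 1"
    by (auto simp: rooted_perms_def)
  \<comment> \<open>The point to be reinserted is the one that \<open>\<tau>\<close> sends to
    \<open>p 1\<close>. It is new: injectivity of \<open>p\<close> keeps it out of \<open>S\<close>,
    and \<open>p 1 \<noteq> \<tau> 1\<close> keeps it away from the root.\<close>
  define w where "w = perm_inv \<tau> (p 1)"
  have \<tau>w: "\<tau> w = p 1" unfolding w_def by (rule permutes_inverses(1)[OF \<tau>])
  have w1: "w \<noteq> 1" using \<tau>w p(3) by auto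
  have wS: "w \<notin> S"
  proof
    assume "w \<in> S"
    then have "p w = p 1" using p(2) \<tau>w by simp
    then show False using w1 permutes_inj[OF p(1)] by (simp add: inj_eq)
  qed
  have pw: "p w = w" using w1 wS permutes_not_in[OF p(1)] by simp
  have "n \<ge> 1"
  proof (rule ccontr)
    assume "\<not> n \<ge> 1"
    then have "\<tau> = id" "S = {}" using \<tau> S by (auto simp: hook_index_def)
    then show False using p by simp
  qed
  then have "p 1 \<in> {1..n}" using permutes_in_image[OF p(1), of 1] S by (auto simp: hook_index_def)
  then have "w \<in> {1..n}" unfolding w_def using permutes_in_image[OF permutes_inv[OF \<tau>]] by blast
  then have "w \<in> {2..n}" using w1 by auto
  then have mem1: "insert w S \<in> hook_index n (Suc b)"
    using S wS hook_index_finite[OF S] by (auto simp: hook_index_def)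
  have "p permutes insert 1 (insert w S)" by (rule permutes_subset[OF p(1)]) auto
  then have "p \<circ> transpose 1 w permutes insert 1 (insert w S)"
    by (intro permutes_compose permutes_swap_id) auto
  moreover have "\<forall>s\<in>insert w S. (p \<circ> transpose 1 w) s = \<tau> s"
  proof
    fix s assume s: "s \<in> insert w S"
    show "(p \<circ> transpose 1 w) s = \<tau> s"
    proof (cases "s = w")
      case True
      then show ?thesis using \<tau>w by simp
    next
      case False
      then have "s \<noteq> 1" "s \<in> S" using s S by (auto simp: hook_index_def)
      then show ?thesis using p(2) False by simp
    qed
  qed
  ultimately have mem: "(insert w S, p \<circ> transpose 1 w) \<in> rooted_perms n (Suc b) \<tau>"
    using mem1 by (auto simp: rooted_perms_def)
  have one: "(p \<circ> transpose 1 w) 1 = w" using pw by simp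
  have eq: "(case q of (S, p) \<Rightarrow> let w = perm_inv \<tau> (p 1) in (insert w S, p \<circ> transpose 1 w))
      = (insert w S, p \<circ> transpose 1 w)"
    by (simp add: q w_def Let_def)
  show "(case q of (S, p) \<Rightarrow> let w = perm_inv \<tau> (p 1) in (insert w S, p \<circ> transpose 1 w))
      \<in> {q. q \<in> rooted_perms n (Suc b) \<tau> \<and> snd q 1 \<noteq> 1}"
    unfolding eq using mem one w1 by simp
  show "(case (case q of (S, p) \<Rightarrow> let w = perm_inv \<tau> (p 1) in (insert w S, p \<circ> transpose 1 w)) of
      (S, p) \<Rightarrow> (S - {p 1}, p \<circ> transpose 1 (p 1))) = q"
    unfolding eq using one wS by (simp add: q comp_assoc)
qed

text \<open>An exterior power of the permutation representation is the sum of two consecutive ones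
  of the standard representation. Pairs over \<open>Suc b\<close> points that move the root cancel
  against pairs over \<open>b\<close> points that disagree with \<open>\<tau>\<close> at the root.
  What remains corresponds to the invariant sets of size \<open>Suc b\<close> without and with
  1.\<close>

lemma hook_char_Suc:
  assumes n: "n \<ge> 1" and \<tau>: "\<tau> permutes {1..n}"
  shows "hook_char n (Suc b) \<tau> + hook_char n b \<tau> = fps_nth (ext_fps {1..n} \<tau>) (Suc b)"
proof -
  have split: "(\<Sum>q\<in>rooted_perms n c \<tau>. sign (snd q))
    = (\<Sum>q | q \<in> rooted_perms n c \<tau> \<and> P (snd q). sign (snd q))
      + (\<Sum>q | q \<in> rooted_perms n c \<tau> \<and> \<not> P (snd q). sign (snd q))" for c P
  proof -
    have "{q. q \<in> rooted_perms n c \<tau> \<and> P (snd q)} = rooted_perms n c \<tau> \<inter> {q. P (snd q)}"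
      "{q. q \<in> rooted_perms n c \<tau> \<and> \<not> P (snd q)} = rooted_perms n c \<tau> - {q. P (snd q)}"
      by blast+
    then show ?thesis
      by (simp only: sum.Int_Diff[OF finite_rooted_perms, of _ n c \<tau> "{q. P (snd q)}"])
  qed
  have "{X. X \<subseteq> {1..n} \<and> \<tau> ` X = X \<and> card X = Suc b}
    = {X. X \<subseteq> {2..n} \<and> \<tau> ` X = X \<and> card X = Suc b}
      \<union> {X. X \<subseteq> {1..n} \<and> 1 \<in> X \<and> \<tau> ` X = X \<and> card X = Suc b}" (is "?E = ?F \<union> ?G")
  proof (rule Set.set_eqI)
    fix X :: "nat set"
    have "X \<subseteq> {2..n} \<longleftrightarrow> X \<subseteq> {1..n} \<and> 1 \<notin> X"
    proof -
      have "{2..n} = {1..n} - {1}" by auto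
      then show ?thesis by (simp add: subset_Diff_insert)
    qed
    then show "X \<in> ?E \<longleftrightarrow> X \<in> ?F \<union> ?G" by blast
  qed
  moreover have "(\<Sum>X\<in>?F \<union> ?G. sign (perm_restrict \<tau> X))
      = (\<Sum>X\<in>?F. sign (perm_restrict \<tau> X)) + (\<Sum>X\<in>?G. sign (perm_restrict \<tau> X))"
  proof (rule sum.union_disjoint)
    show "finite ?F" by (rule finite_subset[of _ "Pow {2..n}"]) auto
    show "finite ?G" by (rule finite_subset[of _ "Pow {1..n}"]) auto
  qed auto
  ultimately have "fps_nth (ext_fps {1..n} \<tau>) (Suc b)
      = (\<Sum>X\<in>?F. sign (perm_restrict \<tau> X)) + (\<Sum>X\<in>?G. sign (perm_restrict \<tau> X))"
    by (simp add: ext_fps_nth)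
  also have "\<dots> = (\<Sum>q\<in>rooted_perms n (Suc b) \<tau>. sign (snd q)) + (\<Sum>q\<in>rooted_perms n b \<tau>. sign (snd q))"
    unfolding split[of "Suc b" "\<lambda>p. p 1 = 1"] split[of b "\<lambda>p. p 1 = \<tau> 1"]
      sum_rooted_perms_cancel[OF \<tau>] sum_rooted_perms_fixing_root sum_rooted_perms_invariant[OF n]
    by (simp add: sum_negf)
  finally show ?thesis by (simp add: hook_char_rooted_perms)
qed

lemma hook_char_0: "hook_char n 0 \<tau> = 1"
proof -
  have "hook_index n 0 = {{}}" by (auto simp: hook_index_def dest: finite_subset)
  then show ?thesis by (simp add: hook_char_def)
qed

lemma hook_fps_ext_fps:
  assumes n: "n \<ge> 1" and \<tau>: "\<tau> permutes {1..n}"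
  shows "(1 + fps_X) * hook_fps n \<tau> = ext_fps {1..n} \<tau>"
proof (rule fps_ext)
  fix b
  show "fps_nth ((1 + fps_X) * hook_fps n \<tau>) b = fps_nth (ext_fps {1..n} \<tau>) b"
  proof (cases b)
    case 0
    have "{X. X \<subseteq> {1..n} \<and> \<tau> ` X = X \<and> card X = 0} = {{}}"
      by (auto dest: finite_subset)
    then have "fps_nth (ext_fps {1..n} \<tau>) 0 = sign (perm_restrict \<tau> {})"
      by (simp add: ext_fps_nth)
    moreover have "perm_restrict \<tau> {} = id" by (simp add: fun_eq_iff perm_restrict_def)
    ultimately show ?thesis by (simp add: 0 hook_char_0 distrib_right)
  next
    case (Suc c)
    then show ?thesis using hook_char_Suc[OF n \<tau>, of c] by (simp add: distrib_right)
  qed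
qed

section \<open>Restriction to blocks and to the swap\<close>

lemma block_perm_permutes:
  assumes p: "p permutes {1..m}" and q: "q permutes {1..m}"
  shows "block_perm m p q permutes {1..2 * m}"
proof (rule bij_imp_permutes)
  have low: "block_perm m p q i = p i" if "i \<le> m" for i using that by (simp add: block_perm_def)
  have high: "block_perm m p q (i + m) = q i + m" if "i \<in> {1..m}" for i
    using that by (simp add: block_perm_def)
  have un: "{1..2 * m} = {1..m} \<union> (\<lambda>i. i + m) ` {1..m}"
  proof -
    have "(\<lambda>i. i + m) ` {1..m} = {1 + m..m + m}" by (rule image_add_atLeastAtMost')
    then show ?thesis by auto
  qed
  show "bij_betw (block_perm m p q) {1..2 * m} {1..2 * m}"
    unfolding un
  proof (rule bij_betw_combine)
    show "bij_betw (block_perm m p q) {1..m} {1..m}"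
      using permutes_imp_bij[OF p] by (subst bij_betw_cong[of _ _ p]) (auto simp: low)
    have "bij_betw ((\<lambda>i. i + m) \<circ> q) {1..m} ((\<lambda>i. i + m) ` {1..m})"
      using permutes_imp_bij[OF q] by (rule bij_betw_trans) (simp add: bij_betw_def)
    then have "bij_betw (block_perm m p q \<circ> (\<lambda>i. i + m)) {1..m} ((\<lambda>i. i + m) ` {1..m})"
      by (subst bij_betw_cong[of _ _ "(\<lambda>i. i + m) \<circ> q"]) (auto simp: high)
    then show "bij_betw (block_perm m p q) ((\<lambda>i. i + m) ` {1..m}) ((\<lambda>i. i + m) ` {1..m})"
      by (subst (asm) bij_betw_comp_iff[symmetric, of _ _ "(\<lambda>i. i + m) ` {1..m}"])
        (auto simp: bij_betw_def)
  qed auto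
next
  fix i assume i: "i \<notin> {1..2 * m}"
  show "block_perm m p q i = i"
  proof (cases "i \<le> m")
    case True
    then have "i \<notin> {1..m}" using i by auto
    then show ?thesis using True permutes_not_in[OF p] by (simp add: block_perm_def)
  next
    case False
    then have "i - m \<notin> {1..m}" using i by auto
    then show ?thesis using False permutes_not_in[OF q] by (simp add: block_perm_def)
  qed
qed

lemma block_perm_comp:
  assumes p: "p permutes {1..m}" and q: "q permutes {1..m}"
  shows "block_perm m p' q' \<circ> block_perm m p q = block_perm m (p' \<circ> p) (q' \<circ> q)"
proof
  fix i
  consider "i \<le> m" | "i - m \<in> {1..m}" "i > m" | "i > 2 * m" by force
  then show "(block_perm m p' q' \<circ> block_perm m p q) i = block_perm m (p' \<circ> p) (q' \<circ> q) i"
  proof cases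
    case 1
    have "p i \<le> m"
    proof (cases "i \<in> {1..m}")
      case True
      then show ?thesis using permutes_in_image[OF p, of i] by simp
    next
      case False
      then show ?thesis using permutes_not_in[OF p, of i] 1 by simp
    qed
    then show ?thesis using 1 by (simp add: block_perm_def)
  next
    case 2
    then have "q (i - m) \<in> {1..m}" using permutes_in_image[OF q] by blast
    then show ?thesis using 2 by (simp add: block_perm_def)
  next
    case 3
    then have "i - m \<notin> {1..m}" by auto
    then have "q (i - m) = i - m" by (rule permutes_not_in[OF q])
    then show ?thesis using 3 by (simp add: block_perm_def)
  qed
qed

lemma swap_halves_involution [simp]: "swap_halves m (swap_halves m i) = i"
  by (auto simp: swap_halves_def)

lemma swap_halves_permutes: "swap_halves m permutes {1..2 * m}"
proof (rule bij_imp_permutes)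
  show "bij_betw (swap_halves m) {1..2 * m} {1..2 * m}"
    by (rule bij_betw_byWitness[where f' = "swap_halves m"]) (auto simp: swap_halves_def)
qed (auto simp: swap_halves_def)

lemma block_perm_swap_halves:
  assumes p: "p permutes {1..m}" and q: "q permutes {1..m}"
  shows "swap_halves m \<circ> block_perm m p q = block_perm m q p \<circ> swap_halves m"
proof
  fix i
  have p0: "p 0 = 0" using permutes_not_in[OF p] by simp
  consider "i = 0" | "i \<in> {1..m}" | "i - m \<in> {1..m}" "i > m" | "i > 2 * m" by force
  then show "(swap_halves m \<circ> block_perm m p q) i = (block_perm m q p \<circ> swap_halves m) i"
  proof cases
    case 1
    then show ?thesis using p0 permutes_not_in[OF q, of 0] by (simp add: block_perm_def swap_halves_def)
  next
    case 2
    then have "p i \<in> {1..m}" using permutes_in_image[OF p] by blast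
    then show ?thesis using 2 by (simp add: block_perm_def swap_halves_def)
  next
    case 3
    then have "q (i - m) \<in> {1..m}" using permutes_in_image[OF q] by blast
    moreover have "i \<le> 2 * m" using 3 by auto
    ultimately show ?thesis using 3 by (simp add: block_perm_def swap_halves_def)
  next
    case 4
    then have "i - m \<notin> {1..m}" by auto
    then have "q (i - m) = i - m" "p (i - m) = i - m"
      using permutes_not_in[OF q] permutes_not_in[OF p] by auto
    then show ?thesis using 4 by (simp add: block_perm_def swap_halves_def)
  qed
qed

text \<open>The upper half is identified with \<open>{1..m}\<close> by \<open>swap_halves m\<close>,
  because \<open>ext_fps_conj\<close> asks for a permutation and a shift of the natural numbers is
  not surjective.\<close>

lemma ext_fps_block_perm:
  assumes p: "p permutes {1..m}" and q: "q permutes {1..m}"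
  shows "ext_fps {1..2 * m} (block_perm m p q) = ext_fps {1..m} p * ext_fps {1..m} q"
proof -
  let ?g = "block_perm m p q"
  have un: "{1..2 * m} = {1..m} \<union> swap_halves m ` {1..m}"
    and disj: "{1..m} \<inter> swap_halves m ` {1..m} = {}"
    and sw: "swap_halves m ` {1..m} = {m + 1..2 * m}"
  proof -
    have "swap_halves m ` {1..m} = (\<lambda>i. i + m) ` {1..m}"
      by (rule image_cong) (auto simp: swap_halves_def)
    also have "\<dots> = {m + 1..2 * m}" by (subst image_add_atLeastAtMost') auto
    finally show sw: "swap_halves m ` {1..m} = {m + 1..2 * m}" .
    then show "{1..2 * m} = {1..m} \<union> swap_halves m ` {1..m}"
      "{1..m} \<inter> swap_halves m ` {1..m} = {}" unfolding sw by auto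
  qed
  have "?g ` {1..m} = p ` {1..m}" by (rule image_cong) (auto simp: block_perm_def)
  then have inv1: "?g ` {1..m} \<subseteq> {1..m}" using permutes_image[OF p] by simp
  have inv2: "?g ` swap_halves m ` {1..m} \<subseteq> swap_halves m ` {1..m}"
  proof
    fix y assume "y \<in> ?g ` swap_halves m ` {1..m}"
    then obtain i where i: "i \<in> {1..m}" "y = ?g (swap_halves m i)" by blast
    then have "y = q i + m" by (simp add: block_perm_def swap_halves_def)
    then show "y \<in> swap_halves m ` {1..m}"
      using permutes_in_image[OF q, of i] i unfolding sw by auto
  qed
  have "ext_fps (swap_halves m ` {1..m}) ?g = ext_fps {1..m} q"
  proof (rule ext_fps_conj)
    show "permutation (swap_halves m)" by (rule permutes_imp_permutation[OF _ swap_halves_permutes]) simp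
    fix i assume i: "i \<in> {1..m}"
    then have "q i \<in> {1..m}" using permutes_in_image[OF q] by blast
    then show "?g (swap_halves m i) = swap_halves m (q i)"
      using i by (simp add: block_perm_def swap_halves_def)
  qed simp
  moreover have "ext_fps {1..m} ?g = ext_fps {1..m} p"
    by (rule ext_fps_cong) (auto simp: block_perm_def)
  ultimately show ?thesis
    unfolding un using ext_fps_Un[OF _ _ disj inv1 inv2] by simp
qed

section \<open>The determinant on the coset of the swap\<close>

lemma sign_perm_restrict_swap_halves:
  assumes "Y \<subseteq> {1..m}"
  shows "permutation (perm_restrict (swap_halves m) (Y \<union> (\<lambda>i. i + m) ` Y))
    \<and> sign (perm_restrict (swap_halves m) (Y \<union> (\<lambda>i. i + m) ` Y)) = (- 1) ^ card Y"
proof -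
  have "finite Y" using assms by (auto intro: finite_subset)
  then show ?thesis using assms
  proof (induction Y)
    case empty
    have "perm_restrict (swap_halves m) {} = id" by (simp add: fun_eq_iff perm_restrict_def)
    then show ?case by (simp add: permutation_id)
  next
    case (insert y Y)
    let ?U = "Y \<union> (\<lambda>i. i + m) ` Y"
    have y: "y \<in> {1..m}" and Y: "Y \<subseteq> {1..m}" using insert.prems by auto
    have yU: "y \<notin> ?U" "y + m \<notin> ?U" using y Y insert.hyps by auto
    have "swap_halves m i \<noteq> y \<and> swap_halves m i \<noteq> y + m" if "i \<in> ?U" for i
      using that yU y Y by (auto simp: swap_halves_def)
    then have "perm_restrict (swap_halves m) (insert y Y \<union> (\<lambda>i. i + m) ` insert y Y)
        = transpose y (y + m) \<circ> perm_restrict (swap_halves m) ?U"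
      using yU y by (auto simp: fun_eq_iff perm_restrict_def transpose_def swap_halves_def)
    moreover have tr: "permutation (transpose y (y + m))" by (rule permutation_swap_id)
    moreover have "sign (transpose y (y + m)) = - 1" using y by (simp add: sign_swap_id)
    moreover have "card (insert y Y) = Suc (card Y)" using insert.hyps by simp
    ultimately show ?case
      using insert.IH[OF Y] permutation_compose[OF tr] sign_compose[OF tr] by (metis power_Suc)
  qed
qed

text \<open>The map sends \<open>i\<close> to \<open>i + m\<close> and \<open>i + m\<close> to
  \<open>r i\<close>. An invariant set therefore consists of an \<open>r\<close>-invariant
  \<open>Y\<close> in the lower half and its shift. The swap restricted to it is a product of
  \<open>card Y\<close> disjoint transpositions, which gives the sign.\<close>

lemma ext_fps_swap_halves:
  assumes r: "r permutes {1..m}"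
  shows "ext_fps {1..2 * m} (block_perm m r id \<circ> swap_halves m)
    = (\<Sum>Y | Y \<subseteq> {1..m} \<and> r ` Y = Y.
        fps_const ((- 1) ^ card Y * sign (perm_restrict r Y)) * fps_X ^ (2 * card Y))"
  unfolding ext_fps_def
proof (rule sum.reindex_bij_witness[of _ "\<lambda>Y. Y \<union> (\<lambda>i. i + m) ` Y" "\<lambda>X. X \<inter> {1..m}"])
  let ?g = "block_perm m r id \<circ> swap_halves m"
  have g1: "?g i = i + m" if "i \<in> {1..m}" for i
    using that by (simp add: block_perm_def swap_halves_def)
  have g2: "?g (i + m) = r i" if "i \<in> {1..m}" for i
    using that by (simp add: block_perm_def swap_halves_def)
  have "?g permutes {1..2 * m}"
    by (intro permutes_compose swap_halves_permutes block_perm_permutes r permutes_id)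
  then have inj: "inj ?g" by (rule permutes_inj)
  fix X assume "X \<in> {X. X \<subseteq> {1..2 * m} \<and> ?g ` X = X}"
  then have X: "X \<subseteq> {1..2 * m}" "?g ` X = X" by auto
  have mem: "?g x \<in> X \<longleftrightarrow> x \<in> X" for x using X(2) inj_image_mem_iff[OF inj, of x X] by simp
  have shift: "i + m \<in> X \<longleftrightarrow> i \<in> X" "r i \<in> X \<longleftrightarrow> i \<in> X" if "i \<in> {1..m}" for i
    using mem[of i] mem[of "i + m"] g1[OF that] g2[OF that] by auto
  show XX: "X \<inter> {1..m} \<union> (\<lambda>i. i + m) ` (X \<inter> {1..m}) = X" (is "?Y \<union> _ = X")
  proof (rule Set.set_eqI, rule iffI)
    fix x assume x: "x \<in> X"
    show "x \<in> ?Y \<union> (\<lambda>i. i + m) ` ?Y"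
    proof (cases "x \<le> m")
      case True
      then show ?thesis using x X by auto
    next
      case False
      then have i: "x - m \<in> {1..m}" "x = (x - m) + m" using x X by auto
      then have "x - m \<in> X" using shift(1)[OF i(1)] x by simp
      then show ?thesis using i by blast
    qed
  qed (use shift in auto)
  have "r ` ?Y \<subseteq> ?Y" using shift permutes_in_image[OF r] by auto
  then have rY: "r ` ?Y = ?Y"
    by (intro card_subset_eq) (auto simp: card_image permutes_inj_on[OF r])
  then show "?Y \<in> {Y. Y \<subseteq> {1..m} \<and> r ` Y = Y}" by auto
  have "perm_restrict ?g X = perm_restrict r ?Y \<circ> perm_restrict (swap_halves m) X"
  proof
    fix x
    show "perm_restrict ?g X x = (perm_restrict r ?Y \<circ> perm_restrict (swap_halves m) X) x"
    proof (cases "x \<in> X")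
      case True
      then consider i where "i \<in> ?Y" "x = i" | i where "i \<in> ?Y" "x = i + m" using XX by blast
      then show ?thesis
      proof cases
        case 1
        then have "swap_halves m x = i + m" "i + m \<notin> ?Y" by (auto simp: swap_halves_def)
        then show ?thesis using True 1 g1[of i] by (simp add: perm_restrict_def)
      next
        case 2
        then have "swap_halves m x = i" by (auto simp: swap_halves_def)
        then show ?thesis using True 2 g2[of i] by (simp add: perm_restrict_def)
      qed
    qed (simp add: perm_restrict_def)
  qed
  moreover have "permutation (perm_restrict r ?Y)"
    using rY by (intro permutes_imp_permutation[OF _ perm_restrict_permutes]) auto
  ultimately have "sign (perm_restrict ?g X) = sign (perm_restrict r ?Y) * (- 1) ^ card ?Y"
    using sign_perm_restrict_swap_halves[of ?Y m] unfolding XX by (simp add: sign_compose)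
  moreover have "card X = 2 * card ?Y"
  proof -
    have "card X = card ?Y + card ((\<lambda>i. i + m) ` ?Y)"
      by (subst XX[symmetric], rule card_Un_disjoint) auto
    then show ?thesis by (simp add: card_image)
  qed
  ultimately show "fps_const ((- 1) ^ card ?Y * sign (perm_restrict r ?Y)) * fps_X ^ (2 * card ?Y)
    = fps_const (sign (perm_restrict ?g X)) * fps_X ^ card X"
    by (simp add: mult.commute)
next
  let ?g = "block_perm m r id \<circ> swap_halves m"
  fix Y assume "Y \<in> {Y. Y \<subseteq> {1..m} \<and> r ` Y = Y}"
  then have Y: "Y \<subseteq> {1..m}" "r ` Y = Y" by auto
  show "(Y \<union> (\<lambda>i. i + m) ` Y) \<inter> {1..m} = Y" using Y by auto
  have "?g ` Y = (\<lambda>i. i + m) ` Y"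
    by (rule image_cong) (use Y in \<open>auto simp: block_perm_def swap_halves_def\<close>)
  moreover have "?g ` (\<lambda>i. i + m) ` Y = r ` Y"
    unfolding image_image
    by (rule image_cong) (use Y in \<open>auto simp: block_perm_def swap_halves_def\<close>)
  ultimately have "?g ` (Y \<union> (\<lambda>i. i + m) ` Y) = Y \<union> (\<lambda>i. i + m) ` Y"
    unfolding image_Un using Y(2) by auto
  then show "Y \<union> (\<lambda>i. i + m) ` Y \<in> {X. X \<subseteq> {1..2 * m} \<and> ?g ` X = X}"
    using Y by auto
qed

lemma ext_fps_swap_halves_nth:
  assumes r: "r permutes {1..m}"
  shows "fps_nth (ext_fps {1..2 * m} (block_perm m r id \<circ> swap_halves m)) b
    = (if even b then (- 1) ^ (b div 2) * fps_nth (ext_fps {1..m} r) (b div 2) else 0)"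
proof -
  have "fps_nth (ext_fps {1..2 * m} (block_perm m r id \<circ> swap_halves m)) b
    = (\<Sum>Y | Y \<subseteq> {1..m} \<and> r ` Y = Y.
        if b = 2 * card Y then (- 1) ^ card Y * sign (perm_restrict r Y) else 0)"
    unfolding ext_fps_swap_halves[OF r] fps_sum_nth
    by (rule sum.cong) (auto simp: fps_X_power_iff)
  also have "\<dots> = (\<Sum>Y | Y \<subseteq> {1..m} \<and> r ` Y = Y.
      if even b then (- 1) ^ (b div 2) * (if card Y = b div 2 then sign (perm_restrict r Y) else 0)
      else 0)"
    by (rule sum.cong) auto
  also have "\<dots> = (if even b then (- 1) ^ (b div 2) * (\<Sum>Y | Y \<subseteq> {1..m} \<and> r ` Y = Y.
      if card Y = b div 2 then sign (perm_restrict r Y) else 0) else 0)"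
    by (simp add: sum_distrib_left)
  also have "(\<Sum>Y | Y \<subseteq> {1..m} \<and> r ` Y = Y.
      if card Y = b div 2 then sign (perm_restrict r Y) else 0) = fps_nth (ext_fps {1..m} r) (b div 2)"
    by (auto simp: ext_fps_def fps_sum_nth fps_X_power_iff intro!: sum.cong)
  finally show ?thesis .
qed

section \<open>Hook characters on the two cosets of the base group\<close>

lemma one_plus_fps_X_neq_0: "1 + fps_X \<noteq> (0 :: int fps)"
proof
  assume "1 + fps_X = (0 :: int fps)"
  then have "fps_nth (1 + fps_X :: int fps) 0 = 0" by simp
  then show False by simp
qed

text \<open>\<open>hook_char\<close> refers to the special point 1, so invariance under conjugation
  is taken from \<open>ext_fps\<close>, which has no such point, and \<open>1 + X\<close> is
  cancelled.\<close>

lemma hook_fps_conj: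
  assumes n: "n \<ge> 1" and \<sigma>: "\<sigma> permutes {1..n}" and \<tau>: "\<tau> permutes {1..n}"
    and h: "h permutes {1..n}" and eq: "\<sigma> \<circ> h = h \<circ> \<tau>"
  shows "hook_fps n \<sigma> = hook_fps n \<tau>"
proof -
  have "ext_fps (h ` {1..n}) \<sigma> = ext_fps {1..n} \<tau>"
    using eq by (intro ext_fps_conj permutes_imp_permutation[OF _ h]) (auto simp: fun_eq_iff)
  then have "(1 + fps_X) * hook_fps n \<sigma> = (1 + fps_X) * hook_fps n \<tau>"
    using hook_fps_ext_fps[OF n \<sigma>] hook_fps_ext_fps[OF n \<tau>] permutes_image[OF h] by simp
  then show ?thesis using one_plus_fps_X_neq_0 by simp
qed

lemma hook_char_conj:
  assumes "n \<ge> 1" "\<sigma> permutes {1..n}" "\<tau> permutes {1..n}" "h permutes {1..n}" "\<sigma> \<circ> h = h \<circ> \<tau>"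
  shows "hook_char n b \<sigma> = hook_char n b \<tau>"
  using hook_fps_conj[OF assms] by (metis hook_fps_nth)

text \<open>Each half contributes a factor \<open>1 + X\<close> to the determinant and the whole set
  absorbs only one; the factor left over produces the two convolutions in the next lemma.\<close>

lemma hook_fps_block_perm:
  assumes m: "m \<ge> 1" and p: "p permutes {1..m}" and q: "q permutes {1..m}"
  shows "hook_fps (2 * m) (block_perm m p q) = (1 + fps_X) * (hook_fps m p * hook_fps m q)"
proof -
  have "2 * m \<ge> 1" using m by simp
  then have "(1 + fps_X) * hook_fps (2 * m) (block_perm m p q)
      = ((1 + fps_X) * hook_fps m p) * ((1 + fps_X) * hook_fps m q)"
    using hook_fps_ext_fps[OF _ block_perm_permutes[OF p q]] hook_fps_ext_fps[OF m p]
      hook_fps_ext_fps[OF m q] ext_fps_block_perm[OF p q] by simp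
  then have "(1 + fps_X) * hook_fps (2 * m) (block_perm m p q)
      = (1 + fps_X) * ((1 + fps_X) * (hook_fps m p * hook_fps m q))"
    by (simp add: mult_ac)
  then show ?thesis using one_plus_fps_X_neq_0 mult_left_cancel by blast
qed

lemma hook_char_block_perm:
  assumes "m \<ge> 1" "p permutes {1..m}" "q permutes {1..m}"
  shows "hook_char (2 * m) b (block_perm m p q)
    = (\<Sum>i\<le>b. hook_char m i p * hook_char m (b - i) q)
      + (\<Sum>i<b. hook_char m i p * hook_char m (b - 1 - i) q)"
proof -
  \<comment> \<open>For \<open>b = 0\<close> there is no coefficient of degree \<open>b - 1\<close>;
    the second sum runs over \<open>{..<b}\<close> because \<open>{0..b - 1}\<close> would then
    still contain 0.\<close>
  have eq: "{0..b - 1} = {..<b}" if "b \<noteq> 0" using that by auto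
  have "hook_char (2 * m) b (block_perm m p q)
      = fps_nth ((1 + fps_X) * (hook_fps m p * hook_fps m q)) b"
    by (simp flip: hook_fps_block_perm[OF assms])
  also have "\<dots> = fps_nth (hook_fps m p * hook_fps m q) b
      + (if b = 0 then 0 else fps_nth (hook_fps m p * hook_fps m q) (b - 1))"
    by (simp only: distrib_right mult_1 fps_add_nth fps_X_mult_nth)
  also have "\<dots> = (\<Sum>i\<le>b. hook_char m i p * hook_char m (b - i) q)
      + (\<Sum>i<b. hook_char m i p * hook_char m (b - 1 - i) q)"
    using eq by (auto simp: fps_mult_nth atLeast0AtMost)
  finally show ?thesis .
qed

text \<open>If \<open>H\<close> is the series of hook characters of \<open>p \<circ> q\<close>, the
  determinant is \<open>(1 - X^2) H(-X^2)\<close>, and division by \<open>1 + X\<close> leaves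
  \<open>(1 - X) H(-X^2)\<close>. Its coefficients in degrees \<open>2 j\<close> and
  \<open>2 j + 1\<close> are, up to sign, the same coefficient \<open>j\<close> of \<open>H\<close>,
  which explains both \<open>b div 2\<close> and the exponent.\<close>

lemma hook_char_swap_halves:
  assumes m: "m \<ge> 1" and p: "p permutes {1..m}" and q: "q permutes {1..m}"
  shows "hook_char (2 * m) b (block_perm m p q \<circ> swap_halves m)
    = (- 1) ^ ((b + 1) div 2) * hook_char m (b div 2) (p \<circ> q)"
proof -
  let ?g = "block_perm m p q \<circ> swap_halves m" and ?g' = "block_perm m (p \<circ> q) id \<circ> swap_halves m"
  have pq: "p \<circ> q permutes {1..m}" by (rule permutes_compose[OF q p])
  have m2: "2 * m \<ge> 1" using m by simp
  have g': "?g' permutes {1..2 * m}"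
    by (intro permutes_compose swap_halves_permutes block_perm_permutes pq permutes_id)
  have g: "?g permutes {1..2 * m}"
    by (intro permutes_compose swap_halves_permutes block_perm_permutes p q)
  \<comment> \<open>Conjugation by \<open>block_perm m id q\<close> gathers both blocks into the
    first one.\<close>
  have "?g \<circ> block_perm m id q = block_perm m p q \<circ> (block_perm m q id \<circ> swap_halves m)"
    by (simp only: comp_assoc block_perm_swap_halves[OF permutes_id q])
  also have "\<dots> = block_perm m (p \<circ> q) q \<circ> swap_halves m"
    by (simp only: comp_assoc[symmetric] block_perm_comp[OF q permutes_id] comp_id)
  also have "\<dots> = block_perm m id q \<circ> ?g'"
    by (simp only: comp_assoc[symmetric] block_perm_comp[OF pq permutes_id] id_comp comp_id)
  finally have "hook_char (2 * m) c ?g = hook_char (2 * m) c ?g'" for c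
    by (intro hook_char_conj[OF m2 g g' block_perm_permutes[OF permutes_id q]])
  define C where "C c = hook_char (2 * m) c ?g'" for c
  define D where "D j = hook_char m j (p \<circ> q)" for j
  have S: "C (Suc c) + C c = (if even (Suc c) then (- 1) ^ (Suc c div 2)
      * fps_nth (ext_fps {1..m} (p \<circ> q)) (Suc c div 2) else 0)" for c
    unfolding C_def hook_char_Suc[OF m2 g'] by (rule ext_fps_swap_halves_nth[OF pq])
  have D: "fps_nth (ext_fps {1..m} (p \<circ> q)) (Suc j) = D (Suc j) + D j" for j
    unfolding D_def by (rule hook_char_Suc[OF m pq, symmetric])
  \<comment> \<open>The recurrence \<open>S\<close> together with \<open>C 0 = 1\<close> determines
    \<open>C\<close>, so the division by \<open>1 + X\<close> amounts to checking the formula in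
    both parities.\<close>
  have "C b = (- 1) ^ ((b + 1) div 2) * D (b div 2)"
  proof (induction b)
    case 0
    show ?case by (simp add: C_def D_def hook_char_0)
  next
    case (Suc b)
    show ?case
    proof (cases "even b")
      case True
      then obtain j where j: "b = 2 * j" by auto
      show ?thesis using S[of b] Suc by (simp add: j)
    next
      case False
      then obtain j where j: "b = 2 * j + 1" by (auto elim: oddE)
      show ?thesis using S[of b] Suc D[of j] by (simp add: j algebra_simps)
    qed
  qed
  then show ?thesis using \<open>\<And>c. hook_char (2 * m) c ?g = hook_char (2 * m) c ?g'\<close>
    by (simp only: C_def D_def)
qed

text \<open>\<open>S\<close> avoids the root, so it has fewer than \<open>n\<close> points. This
  makes hooks with a negative arm contribute 0 automatically.\<close>

lemma hook_char_eq_0: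
  assumes "n \<ge> 1" "b \<ge> n"
  shows "hook_char n b \<tau> = 0"
proof -
  have "S \<notin> hook_index n b" for S
  proof
    assume "S \<in> hook_index n b"
    then have "S \<subseteq> {2..n}" "card S = b" by (auto simp: hook_index_def)
    then show False using card_mono[of "{2..n}" S] assms by simp
  qed
  then have "hook_index n b = {}" by blast
  then show ?thesis by (simp add: hook_char_def)
qed

section \<open>The Sylow subgroups\<close>

lemma carrier_wreath_C2:
  "carrier (wreath_C2 G) = (\<lambda>(s, t, e). Wr s t e) ` (carrier G \<times> carrier G \<times> {1, -1})"
  by (force simp: wreath_C2_def)

lemma mult_wreath_C2 [simp]:
  "Wr s1 s2 e \<otimes>\<^bsub>wreath_C2 G\<^esub> Wr t1 t2 d =
    (if e = 1 then Wr (s1 \<otimes>\<^bsub>G\<^esub> t1) (s2 \<otimes>\<^bsub>G\<^esub> t2) d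
     else Wr (s1 \<otimes>\<^bsub>G\<^esub> t2) (s2 \<otimes>\<^bsub>G\<^esub> t1) (- d))"
  by (simp add: wreath_C2_def)

lemma one_wreath_C2 [simp]: "\<one>\<^bsub>wreath_C2 G\<^esub> = Wr \<one>\<^bsub>G\<^esub> \<one>\<^bsub>G\<^esub> 1"
  by (simp add: wreath_C2_def)

lemma Wr_in_carrier [simp]:
  "Wr s t e \<in> carrier (wreath_C2 G) \<longleftrightarrow> s \<in> carrier G \<and> t \<in> carrier G \<and> (e = 1 \<or> e = -1)"
  by (auto simp: wreath_C2_def)

lemma carrier_wreath_C2E:
  assumes "x \<in> carrier (wreath_C2 G)"
  obtains s t where "s \<in> carrier G" "t \<in> carrier G" "x = Wr s t 1"
    | s t where "s \<in> carrier G" "t \<in> carrier G" "x = Wr s t (-1)"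
  using assms by (auto simp: carrier_wreath_C2)

lemma group_wreath_C2:
  assumes "group G"
  shows "group (wreath_C2 G)"
proof -
  interpret group G by (fact assms)
  show ?thesis
  proof (rule groupI)
    fix x y assume "x \<in> carrier (wreath_C2 G)" "y \<in> carrier (wreath_C2 G)"
    then show "x \<otimes>\<^bsub>wreath_C2 G\<^esub> y \<in> carrier (wreath_C2 G)"
      by (elim carrier_wreath_C2E) simp_all
  next
    fix x y z
    assume "x \<in> carrier (wreath_C2 G)" "y \<in> carrier (wreath_C2 G)" "z \<in> carrier (wreath_C2 G)"
    then show "x \<otimes>\<^bsub>wreath_C2 G\<^esub> y \<otimes>\<^bsub>wreath_C2 G\<^esub> z
        = x \<otimes>\<^bsub>wreath_C2 G\<^esub> (y \<otimes>\<^bsub>wreath_C2 G\<^esub> z)"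
      by (elim carrier_wreath_C2E) (simp_all add: m_assoc)
  next
    fix x assume "x \<in> carrier (wreath_C2 G)"
    then show "\<one>\<^bsub>wreath_C2 G\<^esub> \<otimes>\<^bsub>wreath_C2 G\<^esub> x = x"
      by (elim carrier_wreath_C2E) simp_all
  next
    fix x assume "x \<in> carrier (wreath_C2 G)"
    then show "\<exists>y\<in>carrier (wreath_C2 G). y \<otimes>\<^bsub>wreath_C2 G\<^esub> x = \<one>\<^bsub>wreath_C2 G\<^esub>"
    proof (cases rule: carrier_wreath_C2E)
      case (1 s t)
      then show ?thesis
        by (intro bexI[of _ "Wr (inv\<^bsub>G\<^esub> s) (inv\<^bsub>G\<^esub> t) 1"]) simp_all
    next
      \<comment> \<open>The swap crosses the components, so the two inverses trade places.\<close>
      case (2 s t)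
      then show ?thesis
        by (intro bexI[of _ "Wr (inv\<^bsub>G\<^esub> t) (inv\<^bsub>G\<^esub> s) (-1)"]) simp_all
    qed
  qed simp
qed

lemma group_H_group: "group (H_group k)"
proof (induction k)
  case 0
  show ?case by (rule groupI) auto
next
  case (Suc k)
  then show ?case by (simp add: group_wreath_C2)
qed

lemma finite_H_group [simp]: "finite (carrier (H_group k))"
  by (induction k) (simp_all add: carrier_wreath_C2)

lemma card_H_group_pos: "card (carrier (H_group k)) > 0"
proof -
  interpret group "H_group k" by (rule group_H_group)
  show ?thesis by (auto simp: card_gt_0_iff)
qed

lemma card_H_group_neq_0: "of_nat (card (carrier (H_group k))) \<noteq> (0 :: complex)"
  using card_H_group_pos[of k] by (metis of_nat_eq_0_iff less_irrefl)

lemma inj_Wr: "inj (\<lambda>(s, t, e). Wr s t e)"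
  by (auto simp: inj_def)

lemma card_H_group_Suc: "card (carrier (H_group (Suc k))) = 2 * (card (carrier (H_group k)))\<^sup>2"
  by (simp add: carrier_wreath_C2 card_image[OF inj_on_subset[OF inj_Wr]] power2_eq_square)

lemma sum_H_group_Suc:
  fixes F :: "wr_elt \<Rightarrow> 'a :: comm_monoid_add"
  shows "(\<Sum>g\<in>carrier (H_group (Suc k)). F g)
    = (\<Sum>s\<in>carrier (H_group k). \<Sum>t\<in>carrier (H_group k). F (Wr s t 1))
      + (\<Sum>s\<in>carrier (H_group k). \<Sum>t\<in>carrier (H_group k). F (Wr s t (-1)))"
proof -
  have "(\<Sum>g\<in>carrier (H_group (Suc k)). F g)
    = (\<Sum>(s, t, e)\<in>carrier (H_group k) \<times> carrier (H_group k) \<times> {1, -1}. F (Wr s t e))"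
    unfolding H_group.simps carrier_wreath_C2
    by (subst sum.reindex[OF inj_on_subset[OF inj_Wr]]) (auto simp: case_prod_unfold)
  also have "\<dots> = (\<Sum>s\<in>carrier (H_group k). \<Sum>t\<in>carrier (H_group k). \<Sum>e\<in>{1, -1}. F (Wr s t e))"
    by (simp only: sum.cartesian_product[symmetric])
  finally show ?thesis by (simp add: sum.distrib)
qed

section \<open>Sums over the base group and induced characters\<close>

lemma base_subgroup_eq: "base_subgroup k = (\<lambda>(s, t). Wr s t 1) ` (carrier (H_group k) \<times> carrier (H_group k))"
  by (auto simp: base_subgroup_def)

lemma inj_on_Wr_1: "inj_on (\<lambda>(s, t). Wr s t 1) A"
  by (auto simp: inj_on_def)

lemma base_subgroup_subset: "base_subgroup k \<subseteq> carrier (H_group (Suc k))"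
  by (auto simp: base_subgroup_eq)

lemma card_base_subgroup: "card (base_subgroup k) = (card (carrier (H_group k)))\<^sup>2"
  by (simp add: base_subgroup_eq card_image[OF inj_on_Wr_1] power2_eq_square)

lemma sum_base_subgroup:
  "(\<Sum>g\<in>base_subgroup k. F g) = (\<Sum>s\<in>carrier (H_group k). \<Sum>t\<in>carrier (H_group k). F (Wr s t 1))"
  unfolding base_subgroup_eq sum.cartesian_product
  by (subst sum.reindex[OF inj_on_Wr_1]) (auto simp: case_prod_unfold)

text \<open>Left multiplication by a fixed \<open>s\<close> permutes the group, so products of two
  elements are equidistributed. Off the base group, extended characters depend on such a product
  only.\<close>

lemma sum_mult_reindex:
  fixes F :: "'g \<Rightarrow> 'a :: semiring_1"
  assumes "group G" "finite (carrier G)"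
  shows "(\<Sum>s\<in>carrier G. \<Sum>t\<in>carrier G. F (s \<otimes>\<^bsub>G\<^esub> t))
    = of_nat (card (carrier G)) * (\<Sum>t\<in>carrier G. F t)"
proof -
  interpret group G by (fact assms)
  have "(\<Sum>t\<in>carrier G. F (s \<otimes>\<^bsub>G\<^esub> t)) = (\<Sum>t\<in>carrier G. F t)" if s: "s \<in> carrier G" for s
    by (rule sum.reindex_bij_witness[of _ "\<lambda>t. inv\<^bsub>G\<^esub> s \<otimes>\<^bsub>G\<^esub> t" "\<lambda>t. s \<otimes>\<^bsub>G\<^esub> t"])
      (use s in \<open>auto simp: m_assoc[symmetric]\<close>)
  then show ?thesis by simp
qed

text \<open>Frobenius reciprocity. After the sums are exchanged, conjugation by each fixed
  \<open>x\<close> turns the inner sum into one over \<open>S\<close>, and \<open>\<chi>\<close>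
  does not notice the conjugation.\<close>

lemma sum_induced_char:
  assumes "group G" "finite (carrier G)" and S: "S \<subseteq> carrier G"
    and \<chi>: "\<And>g x. g \<in> carrier G \<Longrightarrow> x \<in> carrier G \<Longrightarrow>
      \<chi> (inv\<^bsub>G\<^esub> x \<otimes>\<^bsub>G\<^esub> g \<otimes>\<^bsub>G\<^esub> x) = \<chi> g"
  shows "(\<Sum>g\<in>carrier G. \<chi> g * induced_char G S f g)
    = of_nat (card (carrier G)) * (\<Sum>s\<in>S. \<chi> s * f s) / of_nat (card S)"
proof -
  interpret group G by (fact assms)
  let ?c = "\<lambda>x g. inv\<^bsub>G\<^esub> x \<otimes>\<^bsub>G\<^esub> g \<otimes>\<^bsub>G\<^esub> x"
  have "(\<Sum>g\<in>carrier G. \<chi> g * induced_char G S f g)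
    = (\<Sum>g\<in>carrier G. \<Sum>x | x \<in> carrier G \<and> ?c x g \<in> S. \<chi> g * f (?c x g)) / of_nat (card S)"
    by (simp add: induced_char_def sum_distrib_left sum_divide_distrib)
  also have "(\<Sum>g\<in>carrier G. \<Sum>x | x \<in> carrier G \<and> ?c x g \<in> S. \<chi> g * f (?c x g))
    = (\<Sum>x\<in>carrier G. \<Sum>g | g \<in> carrier G \<and> ?c x g \<in> S. \<chi> g * f (?c x g))"
    by (rule sum.swap_restrict) (use assms in auto)
  also have "\<dots> = (\<Sum>x\<in>carrier G. \<Sum>s\<in>S. \<chi> s * f s)"
  proof (rule sum.cong[OF refl])
    fix x assume x: "x \<in> carrier G"
    have inv1: "x \<otimes>\<^bsub>G\<^esub> ?c x g \<otimes>\<^bsub>G\<^esub> inv\<^bsub>G\<^esub> x = g" if "g \<in> carrier G" for g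
      using that x by (simp add: m_assoc inv_solve_left')
        (simp add: m_assoc[symmetric])
    have inv2: "?c x (x \<otimes>\<^bsub>G\<^esub> s \<otimes>\<^bsub>G\<^esub> inv\<^bsub>G\<^esub> x) = s" if "s \<in> carrier G" for s
      using that x by (simp add: m_assoc) (simp add: m_assoc[symmetric])
    show "(\<Sum>g | g \<in> carrier G \<and> ?c x g \<in> S. \<chi> g * f (?c x g)) = (\<Sum>s\<in>S. \<chi> s * f s)"
      by (rule sum.reindex_bij_witness[of _ "\<lambda>s. x \<otimes>\<^bsub>G\<^esub> s \<otimes>\<^bsub>G\<^esub> inv\<^bsub>G\<^esub> x" "?c x"])
        (use x S inv1 inv2 \<chi> in auto)
  qed
  finally show ?thesis by simp
qed

section \<open>The embedding into the symmetric group\<close>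

lemma H_perm_Suc [simp]:
  "H_perm (Suc k) (Wr s t 1) = block_perm (2 ^ k) (H_perm k s) (H_perm k t)"
  "H_perm (Suc k) (Wr s t (-1)) = block_perm (2 ^ k) (H_perm k s) (H_perm k t) \<circ> swap_halves (2 ^ k)"
  by (auto simp: fun_eq_iff)

lemma H_perm_0 [simp]: "H_perm 0 s = id"
  by (auto simp: fun_eq_iff)

declare H_perm.simps [simp del]

lemma H_perm_permutes: "s \<in> carrier (H_group k) \<Longrightarrow> H_perm k s permutes {1..2 ^ k}"
proof (induction k arbitrary: s)
  case 0
  show ?case unfolding H_perm_0 by (rule permutes_id)
next
  case (Suc k)
  have sw: "swap_halves (2 ^ k) permutes {1..2 * 2 ^ k}" by (rule swap_halves_permutes)
  have "s \<in> carrier (wreath_C2 (H_group k))" using Suc.prems by simp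
  then show ?case
  proof (cases rule: carrier_wreath_C2E)
    case (1 u v)
    show ?thesis unfolding 1(3) H_perm_Suc power_Suc
      by (rule block_perm_permutes[OF Suc.IH[OF 1(1)] Suc.IH[OF 1(2)]])
  next
    case (2 u v)
    show ?thesis unfolding 2(3) H_perm_Suc power_Suc
      by (rule permutes_compose[OF sw block_perm_permutes[OF Suc.IH[OF 2(1)] Suc.IH[OF 2(2)]]])
  qed
qed

text \<open>Passing the swap through \<open>?B u' v'\<close> exchanges its blocks; this is the
  crossing of components in the product rule for sign -1.\<close>

lemma H_perm_mult:
  "s \<in> carrier (H_group k) \<Longrightarrow> t \<in> carrier (H_group k) \<Longrightarrow>
    H_perm k (s \<otimes>\<^bsub>H_group k\<^esub> t) = H_perm k s \<circ> H_perm k t"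
proof (induction k arbitrary: s t)
  case 0
  then show ?case by simp
next
  case (Suc k)
  let ?B = "\<lambda>u v. block_perm (2 ^ k) (H_perm k u) (H_perm k v)" and ?s = "swap_halves (2 ^ k)"
  note P = H_perm_Suc
  have BB: "?B u v \<circ> ?B u' v' = ?B (u \<otimes>\<^bsub>H_group k\<^esub> u') (v \<otimes>\<^bsub>H_group k\<^esub> v')"
    if "u \<in> carrier (H_group k)" "v \<in> carrier (H_group k)"
      "u' \<in> carrier (H_group k)" "v' \<in> carrier (H_group k)" for u v u' v'
    unfolding block_perm_comp[OF H_perm_permutes[OF that(3)] H_perm_permutes[OF that(4)]]
      Suc.IH[OF that(1,3)] Suc.IH[OF that(2,4)] ..
  have sB: "?s \<circ> ?B u v = ?B v u \<circ> ?s"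
    if "u \<in> carrier (H_group k)" "v \<in> carrier (H_group k)" for u v
    using that by (intro block_perm_swap_halves H_perm_permutes)
  have ss: "?s \<circ> ?s = id" by (simp add: fun_eq_iff)
  have "s \<in> carrier (wreath_C2 (H_group k))" "t \<in> carrier (wreath_C2 (H_group k))"
    using Suc.prems by simp_all
  then show ?case
  proof (elim carrier_wreath_C2E)
    fix u v u' v'
    assume *: "u \<in> carrier (H_group k)" "v \<in> carrier (H_group k)"
      "u' \<in> carrier (H_group k)" "v' \<in> carrier (H_group k)"
    show "H_perm (Suc k) (s \<otimes>\<^bsub>H_group (Suc k)\<^esub> t) = H_perm (Suc k) s \<circ> H_perm (Suc k) t"
      if "s = Wr u v 1" "t = Wr u' v' 1"
      using that BB[OF *] by (simp only: P H_group.simps mult_wreath_C2 simp_thms if_True)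
    show "H_perm (Suc k) (s \<otimes>\<^bsub>H_group (Suc k)\<^esub> t) = H_perm (Suc k) s \<circ> H_perm (Suc k) t"
      if "s = Wr u v 1" "t = Wr u' v' (-1)"
      using that BB[OF *] by (simp only: P H_group.simps mult_wreath_C2 simp_thms if_True comp_assoc[symmetric])
    show "H_perm (Suc k) (s \<otimes>\<^bsub>H_group (Suc k)\<^esub> t) = H_perm (Suc k) s \<circ> H_perm (Suc k) t"
      if "s = Wr u v (-1)" "t = Wr u' v' 1"
    proof -
      have "H_perm (Suc k) s \<circ> H_perm (Suc k) t = ?B u v \<circ> (?s \<circ> ?B u' v')"
        unfolding that P by (rule comp_assoc)
      also have "\<dots> = ?B (u \<otimes>\<^bsub>H_group k\<^esub> v') (v \<otimes>\<^bsub>H_group k\<^esub> u') \<circ> ?s"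
        unfolding sB[OF *(3,4)] comp_assoc[symmetric] BB[OF *(1,2,4,3)] ..
      finally show ?thesis using that by simp
    qed
    show "H_perm (Suc k) (s \<otimes>\<^bsub>H_group (Suc k)\<^esub> t) = H_perm (Suc k) s \<circ> H_perm (Suc k) t"
      if "s = Wr u v (-1)" "t = Wr u' v' (-1)"
    proof -
      have "H_perm (Suc k) s \<circ> H_perm (Suc k) t = ?B u v \<circ> (?s \<circ> ?B u' v') \<circ> ?s"
        unfolding that P by (simp only: comp_assoc)
      also have "\<dots> = ?B u v \<circ> ?B v' u' \<circ> (?s \<circ> ?s)"
        unfolding sB[OF *(3,4)] by (simp only: comp_assoc)
      also have "\<dots> = ?B (u \<otimes>\<^bsub>H_group k\<^esub> v') (v \<otimes>\<^bsub>H_group k\<^esub> u')"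
        unfolding ss BB[OF *(1,2,4,3)] by (rule comp_id)
      finally show ?thesis using that by simp
    qed
  qed
qed

lemma H_perm_one: "H_perm k \<one>\<^bsub>H_group k\<^esub> = id"
  by (induction k) (simp_all add: fun_eq_iff block_perm_def)

lemma perm_inv_H_perm:
  assumes "g \<in> carrier (H_group k)"
  shows "perm_inv (H_perm k (inv\<^bsub>H_group k\<^esub> g)) = H_perm k g"
proof -
  interpret group "H_group k" by (rule group_H_group)
  have "H_perm k (inv\<^bsub>H_group k\<^esub> g) \<circ> H_perm k g = id"
    "H_perm k g \<circ> H_perm k (inv\<^bsub>H_group k\<^esub> g) = id"
    using assms by (simp_all add: H_perm_mult[symmetric] H_perm_one)
  then show ?thesis by (rule inv_unique_comp)
qed


section \<open>Multiplicities as averages\<close>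

text \<open>At height \<open>k\<close> the leg \<open>b\<close> determines the hook. Indexing by the
  leg alone gives a meaning to every \<open>b\<close>, and the value is 0 once the arm would be
  negative, so convolutions can run without bounds on the arm.\<close>

definition hook_mult :: "nat \<Rightarrow> nat \<Rightarrow> tree \<Rightarrow> complex" where
  "hook_mult k b T = (\<Sum>g\<in>carrier (H_group k).
     of_int (hook_char (2 ^ k) b (H_perm k g)) * tree_char k T g) / of_nat (card (carrier (H_group k)))"

text \<open>The inverse in \<open>char_inner\<close> cancels the one in
  \<open>sym_char_hook\<close>.\<close>

lemma mult_r_hook:
  assumes "a + b + 1 = 2 ^ k"
  shows "mult_r k (hook (a, b)) T = hook_mult k b T"
proof -
  interpret group "H_group k" by (rule group_H_group)
  have "sym_char (hook (a, b)) (H_perm k (inv\<^bsub>H_group k\<^esub> g)) = of_int (hook_char (2 ^ k) b (H_perm k g))"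
    if "g \<in> carrier (H_group k)" for g
    unfolding sym_char_hook[OF assms[symmetric] H_perm_permutes[OF inv_closed[OF that]]]
      perm_inv_H_perm[OF that] ..
  then show ?thesis by (simp add: mult_r_def char_inner_def hook_mult_def)
qed

lemma hook_mult_eq_0:
  assumes "b \<ge> 2 ^ k"
  shows "hook_mult k b T = 0"
  using assms by (simp add: hook_mult_def hook_char_eq_0)

text \<open>By \<open>base_mult\<close>, this is the multiplicity of the outer tensor product of the
  characters of \<open>T1\<close> and \<open>T2\<close> in the restriction to the base group; the
  summation indices are leg lengths.\<close>

definition pair_mult :: "nat \<Rightarrow> nat \<Rightarrow> tree \<Rightarrow> tree \<Rightarrow> complex" where
  "pair_mult k b T1 T2 = (\<Sum>i\<le>b. hook_mult k i T1 * hook_mult k (b - i) T2)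
     + (\<Sum>i<b. hook_mult k i T1 * hook_mult k (b - 1 - i) T2)"

lemma sum_product_scaled:
  fixes f g :: "_ \<Rightarrow> complex"
  shows "(\<Sum>s\<in>A. \<Sum>t\<in>A. (\<Sum>i\<in>I. c i s * d i t) * (f s * g t))
    = (\<Sum>i\<in>I. (\<Sum>s\<in>A. c i s * f s) * (\<Sum>t\<in>A. d i t * g t))"
proof -
  have "(\<Sum>s\<in>A. \<Sum>t\<in>A. (\<Sum>i\<in>I. c i s * d i t) * (f s * g t))
      = (\<Sum>s\<in>A. \<Sum>i\<in>I. \<Sum>t\<in>A. (c i s * f s) * (d i t * g t))"
  proof (rule sum.cong[OF refl])
    fix s
    have "(\<Sum>t\<in>A. (\<Sum>i\<in>I. c i s * d i t) * (f s * g t))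
        = (\<Sum>t\<in>A. \<Sum>i\<in>I. (c i s * f s) * (d i t * g t))"
      by (intro sum.cong refl) (simp add: sum_distrib_right sum_distrib_left mult_ac)
    then show "(\<Sum>t\<in>A. (\<Sum>i\<in>I. c i s * d i t) * (f s * g t))
        = (\<Sum>i\<in>I. \<Sum>t\<in>A. (c i s * f s) * (d i t * g t))"
      using sum.swap by (rule trans)
  qed
  also have "\<dots> = (\<Sum>i\<in>I. \<Sum>s\<in>A. \<Sum>t\<in>A. (c i s * f s) * (d i t * g t))"
    by (rule sum.swap)
  finally show ?thesis by (simp add: sum_product)
qed

lemma base_mult:
  "(\<Sum>s\<in>carrier (H_group k). \<Sum>t\<in>carrier (H_group k).
      of_int (hook_char (2 ^ Suc k) b (H_perm (Suc k) (Wr s t 1))) * (tree_char k T1 s * tree_char k T2 t))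
    = (of_nat (card (carrier (H_group k))))\<^sup>2 * pair_mult k b T1 T2"
proof -
  let ?H = "carrier (H_group k)" and ?c = "\<lambda>i s. of_int (hook_char (2 ^ k) i (H_perm k s)) :: complex"
  have h: "of_nat (card ?H) \<noteq> (0 :: complex)" by (rule card_H_group_neq_0)
  have m: "(1::nat) \<le> 2 ^ k" by simp
  have r: "(\<Sum>s\<in>?H. ?c i s * tree_char k T s) = of_nat (card ?H) * hook_mult k i T" for i T
    using h by (simp add: hook_mult_def)
  have "(\<Sum>s\<in>?H. \<Sum>t\<in>?H. of_int (hook_char (2 ^ Suc k) b (H_perm (Suc k) (Wr s t 1)))
        * (tree_char k T1 s * tree_char k T2 t))
    = (\<Sum>s\<in>?H. \<Sum>t\<in>?H. (\<Sum>i\<le>b. ?c i s * ?c (b - i) t) * (tree_char k T1 s * tree_char k T2 t)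
        + (\<Sum>i<b. ?c i s * ?c (b - 1 - i) t) * (tree_char k T1 s * tree_char k T2 t))"
    by (intro sum.cong refl)
      (simp add: hook_char_block_perm[OF m H_perm_permutes H_perm_permutes] distrib_right)
  also have "\<dots> = (\<Sum>i\<le>b. (\<Sum>s\<in>?H. ?c i s * tree_char k T1 s) * (\<Sum>t\<in>?H. ?c (b - i) t * tree_char k T2 t))
      + (\<Sum>i<b. (\<Sum>s\<in>?H. ?c i s * tree_char k T1 s) * (\<Sum>t\<in>?H. ?c (b - 1 - i) t * tree_char k T2 t))"
    by (simp only: sum.distrib sum_product_scaled)
  also have "\<dots> = (of_nat (card ?H))\<^sup>2 * pair_mult k b T1 T2"
    unfolding r pair_mult_def
    by (simp add: sum_distrib_left distrib_left power2_eq_square mult_ac)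
  finally show ?thesis .
qed

text \<open>Both factors depend on \<open>s\<close> and \<open>t\<close> only through their product,
  so equidistribution collapses the double sum to a single multiplicity.\<close>

lemma swap_mult:
  "(\<Sum>s\<in>carrier (H_group k). \<Sum>t\<in>carrier (H_group k).
      of_int (hook_char (2 ^ Suc k) b (H_perm (Suc k) (Wr s t (-1))))
        * tree_char k T (s \<otimes>\<^bsub>H_group k\<^esub> t))
    = (- 1) ^ ((b + 1) div 2) * (of_nat (card (carrier (H_group k))))\<^sup>2 * hook_mult k (b div 2) T"
proof -
  let ?H = "carrier (H_group k)"
  let ?F = "\<lambda>s. of_int (hook_char (2 ^ k) (b div 2) (H_perm k s)) * tree_char k T s"
  have h: "of_nat (card ?H) \<noteq> (0 :: complex)" by (rule card_H_group_neq_0)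
  have m: "(1::nat) \<le> 2 ^ k" by simp
  have eq: "of_int (hook_char (2 ^ Suc k) b (H_perm (Suc k) (Wr s t (-1))))
        * tree_char k T (s \<otimes>\<^bsub>H_group k\<^esub> t) = (- 1) ^ ((b + 1) div 2) * ?F (s \<otimes>\<^bsub>H_group k\<^esub> t)"
    if "s \<in> ?H" "t \<in> ?H" for s t
  proof -
    have "H_perm (Suc k) (Wr s t (-1)) = block_perm (2 ^ k) (H_perm k s) (H_perm k t) \<circ> swap_halves (2 ^ k)"
      by simp
    then have "hook_char (2 ^ Suc k) b (H_perm (Suc k) (Wr s t (-1)))
        = (- 1) ^ ((b + 1) div 2) * hook_char (2 ^ k) (b div 2) (H_perm k (s \<otimes>\<^bsub>H_group k\<^esub> t))"
      using hook_char_swap_halves[OF m H_perm_permutes[OF that(1)] H_perm_permutes[OF that(2)]] that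
      by (simp only: power_Suc H_perm_mult)
    then show ?thesis by simp
  qed
  have "(\<Sum>s\<in>?H. \<Sum>t\<in>?H. of_int (hook_char (2 ^ Suc k) b (H_perm (Suc k) (Wr s t (-1))))
        * tree_char k T (s \<otimes>\<^bsub>H_group k\<^esub> t))
      = (- 1) ^ ((b + 1) div 2) * (\<Sum>s\<in>?H. \<Sum>t\<in>?H. ?F (s \<otimes>\<^bsub>H_group k\<^esub> t))"
    unfolding sum_distrib_left by (intro sum.cong refl eq)
  also have "(\<Sum>s\<in>?H. \<Sum>t\<in>?H. ?F (s \<otimes>\<^bsub>H_group k\<^esub> t)) = of_nat (card ?H) * (\<Sum>s\<in>?H. ?F s)"
    by (rule sum_mult_reindex[OF group_H_group finite_H_group])
  also have "(\<Sum>s\<in>?H. ?F s) = of_nat (card ?H) * hook_mult k (b div 2) T"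
    using h by (simp add: hook_mult_def)
  finally show ?thesis by (simp add: power2_eq_square del: H_perm_Suc)
qed

text \<open>The group has twice the order of its base group, which is where both halves come from;
  \<open>\<epsilon>\<close> is felt on the other coset only.\<close>

lemma hook_mult_ext:
  assumes "tree_char (Suc k) T = ext_char k \<epsilon> (tree_char k T1)"
  shows "hook_mult (Suc k) b T = pair_mult k b T1 T1 / 2
    + \<epsilon> * (- 1) ^ ((b + 1) div 2) / 2 * hook_mult k (b div 2) T1"
proof -
  let ?h = "of_nat (card (carrier (H_group k))) :: complex"
  have "(\<Sum>g\<in>carrier (H_group (Suc k)).
      of_int (hook_char (2 ^ Suc k) b (H_perm (Suc k) g)) * tree_char (Suc k) T g)
    = ?h\<^sup>2 * pair_mult k b T1 T1 + \<epsilon> * ((- 1) ^ ((b + 1) div 2) * ?h\<^sup>2 * hook_mult k (b div 2) T1)"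
    unfolding sum_H_group_Suc base_mult[symmetric] swap_mult[symmetric] sum_distrib_left assms ext_char_def
    by (simp add: mult_ac del: H_perm_Suc power_Suc)
  then have "hook_mult (Suc k) b T = (?h\<^sup>2 * pair_mult k b T1 T1
      + \<epsilon> * ((- 1) ^ ((b + 1) div 2) * ?h\<^sup>2 * hook_mult k (b div 2) T1)) / (2 * ?h\<^sup>2)"
    unfolding hook_mult_def card_H_group_Suc by simp
  also have "\<dots> = pair_mult k b T1 T1 / 2 + \<epsilon> * (- 1) ^ ((b + 1) div 2) / 2 * hook_mult k (b div 2) T1"
  proof -
    have "(h\<^sup>2 * x + e * (c * h\<^sup>2 * y)) / (2 * h\<^sup>2) = x / 2 + e * c / 2 * y"
      if "h \<noteq> 0" for h x y e c :: complex
      using that by (simp add: field_simps)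
    then show ?thesis using card_H_group_neq_0 by blast
  qed
  finally show ?thesis .
qed

text \<open>Since hook characters are class functions, reciprocity replaces the average over the
  group by one over the base group. The index 2 cancels, so no half appears.\<close>

lemma hook_mult_ind:
  assumes "tree_char (Suc k) T = induced_char (H_group (Suc k)) (base_subgroup k)
      (outer_tensor (tree_char k T1) (tree_char k T2))"
  shows "hook_mult (Suc k) b T = pair_mult k b T1 T2"
proof -
  let ?h = "of_nat (card (carrier (H_group k))) :: complex" and ?G = "H_group (Suc k)"
  let ?\<chi> = "\<lambda>g. of_int (hook_char (2 ^ Suc k) b (H_perm (Suc k) g)) :: complex"
  interpret group ?G by (rule group_H_group)
  have h: "?h \<noteq> 0" by (rule card_H_group_neq_0)
  have hG: "of_nat (card (carrier ?G)) \<noteq> (0 :: complex)" by (rule card_H_group_neq_0)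
  have inv: "?\<chi> (inv\<^bsub>?G\<^esub> x \<otimes>\<^bsub>?G\<^esub> g \<otimes>\<^bsub>?G\<^esub> x) = ?\<chi> g"
    if "g \<in> carrier ?G" "x \<in> carrier ?G" for g x
  proof -
    let ?y = "inv\<^bsub>?G\<^esub> x \<otimes>\<^bsub>?G\<^esub> g \<otimes>\<^bsub>?G\<^esub> x"
    have y: "?y \<in> carrier ?G" using that by blast
    have "x \<otimes>\<^bsub>?G\<^esub> ?y = g \<otimes>\<^bsub>?G\<^esub> x" using that inv_solve_left m_assoc by (metis inv_closed m_closed)
    then have "H_perm (Suc k) g \<circ> H_perm (Suc k) x = H_perm (Suc k) x \<circ> H_perm (Suc k) ?y"
      using that y by (simp only: H_perm_mult[symmetric])
    then have "hook_char (2 ^ Suc k) b (H_perm (Suc k) g) = hook_char (2 ^ Suc k) b (H_perm (Suc k) ?y)"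
      using that y by (intro hook_char_conj[where h = "H_perm (Suc k) x"] H_perm_permutes) auto
    then show ?thesis by simp
  qed
  have "(\<Sum>g\<in>carrier ?G. ?\<chi> g * tree_char (Suc k) T g)
      = of_nat (card (carrier ?G)) * (\<Sum>s\<in>base_subgroup k. ?\<chi> s
          * outer_tensor (tree_char k T1) (tree_char k T2) s) / of_nat (card (base_subgroup k))"
    unfolding assms using inv
    by (rule sum_induced_char[OF group_H_group finite_H_group base_subgroup_subset])
  also have "(\<Sum>s\<in>base_subgroup k. ?\<chi> s * outer_tensor (tree_char k T1) (tree_char k T2) s)
      = ?h\<^sup>2 * pair_mult k b T1 T2"
    unfolding sum_base_subgroup base_mult[symmetric] outer_tensor_def by simp
  also have "of_nat (card (base_subgroup k)) = ?h\<^sup>2" by (simp add: card_base_subgroup)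
  finally have "(\<Sum>g\<in>carrier ?G. ?\<chi> g * tree_char (Suc k) T g)
      = of_nat (card (carrier ?G)) * pair_mult k b T1 T2"
    using h by simp
  then show ?thesis using hG unfolding hook_mult_def by simp
qed

section \<open>Characters of trees by the shape of the root\<close>

lemma tree_char_single: "tree_char (Suc k) (Node {#T1#}) = ext_char k (-1) (tree_char k T1)"
  by simp

lemma tree_char_double: "tree_char (Suc k) (Node {#T1, T1#}) = ext_char k 1 (tree_char k T1)"
proof -
  have "{#T1, T1#} = {#U, V#} \<longleftrightarrow> U = T1 \<and> V = T1" for U V :: tree
    by (auto simp: add_eq_conv_ex)
  moreover have "(SOME q :: tree \<times> tree. fst q = T1 \<and> snd q = T1) = (T1, T1)"
    by (rule some_equality) auto
  ultimately show ?thesis by (simp add: case_prod_unfold)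
qed

text \<open>\<open>tree_char\<close> orders the subtrees by an arbitrary choice, so either order may
  occur; \<open>pair_mult_commute\<close> later makes this harmless.\<close>

lemma tree_char_pair:
  assumes "T1 \<noteq> T2"
  obtains U V where "(U, V) = (T1, T2) \<or> (U, V) = (T2, T1)"
    "tree_char (Suc k) (Node {#T1, T2#}) = induced_char (H_group (Suc k)) (base_subgroup k)
      (outer_tensor (tree_char k U) (tree_char k V))"
proof -
  let ?P = "\<lambda>(U, V). Node {#T1, T2#} = Node {#U, V#}"
  obtain U V where UV: "(SOME q. ?P q) = (U, V)" by (cases "SOME q. ?P q")
  have "?P (SOME q. ?P q)" by (rule someI[of ?P "(T1, T2)"]) simp
  then have "{#T1, T2#} = {#U, V#}" unfolding UV by simp
  then have "(U, V) = (T1, T2) \<or> (U, V) = (T2, T1)" by (auto simp: add_eq_conv_ex)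
  moreover have "tree_char (Suc k) (Node {#T1, T2#}) = induced_char (H_group (Suc k)) (base_subgroup k)
      (outer_tensor (tree_char k U) (tree_char k V))"
    using calculation assms UV by auto
  ultimately show ?thesis by (rule that)
qed

section \<open>Domino tilings of hooks\<close>

lemma domino_in_hook:
  assumes "horizontal_domino d \<or> vertical_domino d" "d \<subseteq> diagram (hook (a, b))"
  obtains i where "i < b" "d = {(i, 0), (i + 1, 0)}" | j where "j < a" "d = {(0, j), (0, j + 1)}"
proof -
  from assms(1) show ?thesis
  proof
    assume "horizontal_domino d"
    then obtain i j where d: "d = {(i, j), (i, j + 1)}" by (auto simp: horizontal_domino_def)
    then have "i = 0" "j < a" using assms(2) by (auto simp: diagram_hook)
    then show ?thesis using d that(2) by blast
  next
    assume "vertical_domino d"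
    then obtain i j where d: "d = {(i, j), (i + 1, j)}" by (auto simp: vertical_domino_def)
    then have "j = 0" "i < b" using assms(2) by (auto simp: diagram_hook)
    then show ?thesis using d that(1) by blast
  qed
qed

text \<open>Dominoes are forced from the free ends of leg and arm towards the corner; hence the
  parity of the distance to the end.\<close>

definition hook_tiling :: "nat \<Rightarrow> nat \<Rightarrow> (nat \<times> nat) set set" where
  "hook_tiling a b = (\<lambda>i. {(i, 0), (i + 1, 0)}) ` {i. i < b \<and> odd (b - i)}
     \<union> (\<lambda>j. {(0, j), (0, j + 1)}) ` {j. j < a \<and> odd (a - j)}"

lemma alternating_downwards:
  fixes Q :: "nat \<Rightarrow> bool"
  assumes "\<not> Q c" "\<And>i. i < c \<Longrightarrow> Q i \<longleftrightarrow> \<not> Q (i + 1)" "i \<le> c"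
  shows "Q i \<longleftrightarrow> odd (c - i)"
  using \<open>i \<le> c\<close>
proof (induction i rule: inc_induct)
  case base
  then show ?case using assms(1) by simp
next
  case (step i)
  have "c - i = Suc (c - Suc i)" using step by simp
  then show ?case using step assms(2)[of i] by simp
qed

lemma domino_tiling_hook_unique:
  assumes P: "domino_tiling P (diagram (hook (a, b)))"
  shows "P = hook_tiling a b"
proof -
  have dom: "\<And>d. d \<in> P \<Longrightarrow> horizontal_domino d \<or> vertical_domino d"
    and disj: "pairwise disjnt P" and un: "\<Union>P = diagram (hook (a, b))"
    using P by (auto simp: domino_tiling_def)
  let ?v = "\<lambda>i. {(i, 0), (i + 1, 0)} :: (nat \<times> nat) set"
  let ?h = "\<lambda>j. {(0, j), (0, j + 1)} :: (nat \<times> nat) set"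
  have cases: "(\<exists>i<b. d = ?v i) \<or> (\<exists>j<a. d = ?h j)" if "d \<in> P" for d
  proof -
    have "d \<subseteq> diagram (hook (a, b))" using that un by auto
    then show ?thesis using domino_in_hook[OF dom[OF that]] by metis
  qed
  have eq: "d = e" if "d \<in> P" "e \<in> P" "x \<in> d" "x \<in> e" for d e x
    using disj that by (auto simp: pairwise_def disjnt_def)
  have v: "?v i \<in> P \<longleftrightarrow> odd (b - i)" if "i \<le> b" for i
  proof (rule alternating_downwards[OF _ _ that])
    show "?v b \<notin> P"
    proof
      assume "?v b \<in> P"
      then have "(b + 1, 0) \<in> diagram (hook (a, b))" using un by blast
      then show False by (auto simp: diagram_hook)
    qed
    fix i assume "i < b"
    \<comment> \<open>A leg cell other than the corner can be covered only by the vertical domino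
      that starts at it or just above it, and by disjointness not by both.\<close>
    then have "(i + 1, 0) \<in> \<Union>P" by (auto simp: un diagram_hook)
    then obtain d where d: "d \<in> P" "(i + 1, 0) \<in> d" by blast
    then have "d = ?v i \<or> d = ?v (i + 1)" using cases[OF d(1)] by auto
    moreover have "?v i \<noteq> ?v (i + 1)" by (simp add: doubleton_eq_iff)
    then have "\<not> (?v i \<in> P \<and> ?v (i + 1) \<in> P)"
      using eq[of "?v i" "?v (i + 1)" "(i + 1, 0)"] by blast
    ultimately show "?v i \<in> P \<longleftrightarrow> ?v (i + 1) \<notin> P" using d(1) by blast
  qed
  have h: "?h j \<in> P \<longleftrightarrow> odd (a - j)" if "j \<le> a" for j
  proof (rule alternating_downwards[OF _ _ that])
    show "?h a \<notin> P"
    proof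
      assume "?h a \<in> P"
      then have "(0, a + 1) \<in> diagram (hook (a, b))" using un by blast
      then show False by (auto simp: diagram_hook)
    qed
    fix j assume "j < a"
    then have "(0, j + 1) \<in> \<Union>P" by (auto simp: un diagram_hook)
    then obtain d where d: "d \<in> P" "(0, j + 1) \<in> d" by blast
    then have "d = ?h j \<or> d = ?h (j + 1)" using cases[OF d(1)] by auto
    moreover have "?h j \<noteq> ?h (j + 1)" by (simp add: doubleton_eq_iff)
    then have "\<not> (?h j \<in> P \<and> ?h (j + 1) \<in> P)"
      using eq[of "?h j" "?h (j + 1)" "(0, j + 1)"] by blast
    ultimately show "?h j \<in> P \<longleftrightarrow> ?h (j + 1) \<notin> P" using d(1) by blast
  qed
  show ?thesis
  proof (rule Set.set_eqI, rule iffI)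
    fix d assume d: "d \<in> P"
    from cases[OF d] show "d \<in> hook_tiling a b"
    proof (elim disjE exE conjE)
      fix i assume i: "i < b" "d = ?v i"
      then have "odd (b - i)" using v[of i] d by simp
      then show ?thesis using i unfolding hook_tiling_def by blast
    next
      fix j assume j: "j < a" "d = ?h j"
      then have "odd (a - j)" using h[of j] d by simp
      then show ?thesis using j unfolding hook_tiling_def by blast
    qed
  next
    fix d assume "d \<in> hook_tiling a b"
    then show "d \<in> P"
      unfolding hook_tiling_def
    proof (elim UnE imageE CollectE conjE)
      fix i assume "d = ?v i" "i < b" "odd (b - i)"
      then show ?thesis using v[of i] by simp
    next
      fix j assume "d = ?h j" "j < a" "odd (a - j)"
      then show ?thesis using h[of j] by simp
    qed
  qed
qed

lemma domino_tiling_hook_tiling: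
  assumes "odd (a + b)"
  shows "domino_tiling (hook_tiling a b) (diagram (hook (a, b)))"
  unfolding domino_tiling_def
proof (intro conjI ballI)
  fix d assume "d \<in> hook_tiling a b"
  then show "horizontal_domino d \<or> vertical_domino d"
    unfolding hook_tiling_def horizontal_domino_def vertical_domino_def by blast
next
  have sep: "i = j" if "odd (c - i)" "odd (c - j)" "i < c" "j < c"
    "i = j \<or> i = j + 1 \<or> i + 1 = j" for c i j :: nat
    using that by (elim disjE) (auto simp: Suc_diff_Suc[symmetric])
  \<comment> \<open>Dominoes of different directions can meet only in the corner, and having both
    there would require \<open>a\<close> and \<open>b\<close> to be odd.\<close>
  have cross: "\<not> (odd (b - 0) \<and> odd (a - 0))" using assms by auto
  show "pairwise disjnt (hook_tiling a b)"
  proof (rule pairwiseI)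
    fix d e assume de: "d \<in> hook_tiling a b" "e \<in> hook_tiling a b" "d \<noteq> e"
    show "disjnt d e"
    proof (rule ccontr)
      assume nd: "\<not> disjnt d e"
      from de(1,2) nd have "d = e"
        unfolding hook_tiling_def
        using sep[of b] sep[of a] cross
        by (elim UnE imageE) (auto simp: disjnt_def)
      then show False using de(3) by simp
    qed
  qed
next
  show "\<Union> (hook_tiling a b) = diagram (hook (a, b))"
  proof (rule Set.set_eqI, rule iffI)
    fix x assume "x \<in> \<Union> (hook_tiling a b)"
    then show "x \<in> diagram (hook (a, b))" by (auto simp: hook_tiling_def diagram_hook)
  next
    fix x assume x: "x \<in> diagram (hook (a, b))"
    have vert: "\<exists>i. i < b \<and> odd (b - i) \<and> (l = i \<or> l = i + 1)"
      if "l \<le> b" "l > 0 \<or> odd b" for l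
    proof (cases "odd (b - l)")
      case True
      then have "l < b" by (cases "l = b") (use that in auto)
      then show ?thesis using True by blast
    next
      case False
      then have "l > 0" using that by (cases l) auto
      then have "b - (l - 1) = Suc (b - l)" "l - 1 < b" "l = (l - 1) + 1" using that by auto
      then show ?thesis using False by (metis even_Suc)
    qed
    have horiz: "\<exists>j. j < a \<and> odd (a - j) \<and> (l = j \<or> l = j + 1)"
      if "l \<le> a" "l > 0 \<or> odd a" for l
    proof (cases "odd (a - l)")
      case True
      then have "l < a" by (cases "l = a") (use that in auto)
      then show ?thesis using True by blast
    next
      case False
      then have "l > 0" using that by (cases l) auto
      then have "a - (l - 1) = Suc (a - l)" "l - 1 < a" "l = (l - 1) + 1" using that by auto
      then show ?thesis using False by (metis even_Suc)
    qed
    \<comment> \<open>The corner counts as a leg cell if \<open>b\<close> is odd and as an arm cell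
      if \<open>a\<close> is odd; exactly one of these holds.\<close>
    obtain l where "x = (l, 0) \<and> l \<le> b \<and> (l > 0 \<or> odd b) \<or> x = (0, l) \<and> l \<le> a \<and> (l > 0 \<or> odd a)"
      using x assms by (fastforce simp: diagram_hook)
    then show "x \<in> \<Union> (hook_tiling a b)"
    proof
      assume l: "x = (l, 0) \<and> l \<le> b \<and> (l > 0 \<or> odd b)"
      then obtain i where "i < b" "odd (b - i)" "l = i \<or> l = i + 1" using vert by blast
      then have "{(i, 0), (i + 1, 0)} \<in> hook_tiling a b" "x \<in> {(i, 0), (i + 1, 0)}"
        using l by (auto simp: hook_tiling_def)
      then show ?thesis by blast
    next
      assume l: "x = (0, l) \<and> l \<le> a \<and> (l > 0 \<or> odd a)"
      then obtain j where "j < a" "odd (a - j)" "l = j \<or> l = j + 1" using horiz by blast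
      then have "{(0, j), (0, j + 1)} \<in> hook_tiling a b" "x \<in> {(0, j), (0, j + 1)}"
        using l by (auto simp: hook_tiling_def)
      then show ?thesis by blast
    qed
  qed
qed

lemma card_odd_diff: "card {i. i < b \<and> odd (b - i)} = (b + 1) div 2"
proof -
  have "{i. i < b \<and> odd (b - i)} = (\<lambda>j. b - 1 - 2 * j) ` {..<(b + 1) div 2}"
  proof (rule Set.set_eqI, rule iffI)
    fix i assume "i \<in> {i. i < b \<and> odd (b - i)}"
    then have "i < b" "odd (b - i)" by auto
    from this(2) obtain j where "b - i = 2 * j + 1" by (rule oddE)
    then have "i = b - 1 - 2 * j" "j < (b + 1) div 2" using \<open>i < b\<close> by auto
    then show "i \<in> (\<lambda>j. b - 1 - 2 * j) ` {..<(b + 1) div 2}" by blast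
  next
    fix i assume "i \<in> (\<lambda>j. b - 1 - 2 * j) ` {..<(b + 1) div 2}"
    then obtain j where "j < (b + 1) div 2" "i = b - 1 - 2 * j" by auto
    then have "b - i = 2 * j + 1" "i < b" by auto
    moreover from this(1) have "odd (b - i)" by simp
    ultimately show "i \<in> {i. i < b \<and> odd (b - i)}" by blast
  qed
  moreover have "inj_on (\<lambda>j. b - 1 - 2 * j) {..<(b + 1) div 2}" by (rule inj_onI) auto
  ultimately show ?thesis by (simp add: card_image)
qed

text \<open>This is the exponent found in \<open>hook_char_swap_halves\<close>, so the sign there
  becomes the sign of the tiling.\<close>

lemma vert_hook:
  assumes "odd (a + b)"
  shows "vert (hook (a, b)) = (b + 1) div 2"
proof -
  have "(THE P. domino_tiling P (diagram (hook (a, b)))) = hook_tiling a b"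
    using domino_tiling_hook_tiling[OF assms] domino_tiling_hook_unique by (rule the_equality)
  moreover have "{d \<in> hook_tiling a b. vertical_domino d}
      = (\<lambda>i. {(i, 0), (i + 1, 0)}) ` {i. i < b \<and> odd (b - i)}"
    by (auto simp: hook_tiling_def vertical_domino_def doubleton_eq_iff)
  moreover have "inj_on (\<lambda>i. {(i, 0), (i + 1, 0)} :: (nat \<times> nat) set) A" for A
    by (rule inj_onI) (auto simp: doubleton_eq_iff)
  ultimately show ?thesis by (simp only: vert_def card_image card_odd_diff)
qed

section \<open>The recursion\<close>

lemma sum_antidiagonal_split:
  fixes f :: "nat \<Rightarrow> nat \<Rightarrow> 'a :: comm_monoid_add"
  shows "(\<Sum>i\<le>n. f i (n - i)) = (\<Sum>i | 2 * i < n. f i (n - i) + f (n - i) i)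
    + (if even n then f (n div 2) (n div 2) else 0)"
proof -
  have fin: "finite {i. 2 * i < n}" "finite {i. 2 * i = n}" "finite {i. i \<le> n \<and> n < 2 * i}"
    by (auto intro: finite_subset[of _ "{..n}"])
  have "{..n} = ({i. 2 * i < n} \<union> {i. i \<le> n \<and> n < 2 * i}) \<union> {i. 2 * i = n}" by auto
  then have "(\<Sum>i\<le>n. f i (n - i)) = (\<Sum>i | 2 * i < n. f i (n - i))
      + (\<Sum>i | i \<le> n \<and> n < 2 * i. f i (n - i)) + (\<Sum>i | 2 * i = n. f i (n - i))"
    using fin by (simp only:) (subst sum.union_disjoint; (auto)?)+
  also have "(\<Sum>i | i \<le> n \<and> n < 2 * i. f i (n - i)) = (\<Sum>i | 2 * i < n. f (n - i) i)"
    by (rule sum.reindex_bij_witness[of _ "\<lambda>i. n - i" "\<lambda>i. n - i"]) auto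
  also have "(\<Sum>i | 2 * i = n. f i (n - i)) = (if even n then f (n div 2) (n div 2) else 0)"
  proof (cases "even n")
    case True
    then have "{i. 2 * i = n} = {n div 2}" "n - n div 2 = n div 2" by auto
    then show ?thesis using True by simp
  next
    case False
    then have "{i. 2 * i = n} = {}" by auto
    then show ?thesis using False by simp
  qed
  finally show ?thesis by (simp add: sum.distrib)
qed

lemma pair_mult_commute: "pair_mult k b T1 T2 = pair_mult k b T2 T1"
proof -
  let ?f = "\<lambda>T i. hook_mult k i T"
  have "(\<Sum>i\<le>b. ?f T1 i * ?f T2 (b - i)) = (\<Sum>i\<le>b. ?f T2 i * ?f T1 (b - i))"
    by (rule sum.reindex_bij_witness[of _ "\<lambda>i. b - i" "\<lambda>i. b - i"]) auto
  moreover have "(\<Sum>i<b. ?f T1 i * ?f T2 (b - 1 - i)) = (\<Sum>i<b. ?f T2 i * ?f T1 (b - 1 - i))"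
    by (rule sum.reindex_bij_witness[of _ "\<lambda>i. b - 1 - i" "\<lambda>i. b - 1 - i"]) auto
  ultimately show ?thesis by (simp only: pair_mult_def)
qed

text \<open>Both antidiagonals are folded at their middle. One of \<open>b\<close> and
  \<open>b - 1\<close> is even, and in either case its middle index is \<open>b div 2\<close>, which
  yields the last product. For odd \<open>b\<close> the range \<open>2 * i < b\<close> contains this
  middle index of the antidiagonal \<open>b - 1\<close>, and the condition
  \<open>i \<noteq> b div 2\<close> removes it there; for even \<open>b\<close> the condition always
  holds.\<close>

lemma pair_mult_eq_half_sum:
  "pair_mult k b T1 T2
    = (\<Sum>i | 2 * i < b. hook_mult k i T1 * ((if i \<noteq> b div 2 then hook_mult k (b - 1 - i) T2 else 0)
          + hook_mult k (b - i) T2)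
        + hook_mult k i T2 * ((if i \<noteq> b div 2 then hook_mult k (b - 1 - i) T1 else 0)
          + hook_mult k (b - i) T1))
      + hook_mult k (b div 2) T1 * hook_mult k (b div 2) T2"
proof (cases b)
  case 0
  then show ?thesis by (simp add: pair_mult_def)
next
  case (Suc c)
  let ?f = "\<lambda>i j. hook_mult k i T1 * hook_mult k j T2"
  let ?d = "?f (b div 2) (b div 2)"
  have fin: "finite {i. 2 * i < b}" by (auto intro: finite_subset[of _ "{..b}"])
  have "{i. 2 * i < c} = {i \<in> {i. 2 * i < b}. i \<noteq> b div 2}" using Suc by auto
  then have c: "(\<Sum>i | 2 * i < c. ?f i (c - i) + ?f (c - i) i)
    = (\<Sum>i | 2 * i < b. if i \<noteq> b div 2 then ?f i (c - i) + ?f (c - i) i else 0)"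
    using sum.inter_filter[OF fin] by simp
  have "{..<b} = {..c}" "b - 1 = c" using Suc by auto
  then have "pair_mult k b T1 T2 = (\<Sum>i\<le>b. ?f i (b - i)) + (\<Sum>i\<le>c. ?f i (c - i))"
    by (simp add: pair_mult_def)
  also have "\<dots> = (\<Sum>i | 2 * i < b. ?f i (b - i) + ?f (b - i) i)
      + (\<Sum>i | 2 * i < b. if i \<noteq> b div 2 then ?f i (c - i) + ?f (c - i) i else 0) + ?d"
    unfolding sum_antidiagonal_split[of ?f] c using Suc by auto
  also have "(\<Sum>i | 2 * i < b. ?f i (b - i) + ?f (b - i) i)
      + (\<Sum>i | 2 * i < b. if i \<noteq> b div 2 then ?f i (c - i) + ?f (c - i) i else 0)
    = (\<Sum>i | 2 * i < b. hook_mult k i T1 * ((if i \<noteq> b div 2 then hook_mult k (b - 1 - i) T2 else 0)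
          + hook_mult k (b - i) T2)
        + hook_mult k i T2 * ((if i \<noteq> b div 2 then hook_mult k (b - 1 - i) T1 else 0)
          + hook_mult k (b - i) T1))"
    unfolding sum.distrib[symmetric]
    by (rule sum.cong) (auto simp: Suc algebra_simps)
  finally show ?thesis .
qed

text \<open>Whichever of \<open>a\<close> and \<open>b\<close> is odd, half of the hook has leg
  \<open>b div 2\<close>, the index that arises on the swapped coset and in the middle of the
  antidiagonal.\<close>

lemma half_hook_eq:
  assumes "a + b + 1 = 2 * m"
  obtains a' where "half_hook (a, b) = (a', b div 2)" "a' + b div 2 + 1 = m"
proof (cases "odd a")
  case True
  then obtain c where c: "a = 2 * c + 1" by (rule oddE)
  have "even b" using arg_cong[OF assms, of even] by (simp add: c)
  then obtain d where d: "b = 2 * d" by (rule evenE)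
  show ?thesis by (rule that[of c]) (use assms in \<open>auto simp: half_hook_def c d\<close>)
next
  case False
  then obtain c where c: "a = 2 * c" by auto
  have "odd b" using arg_cong[OF assms, of even] by (simp add: c)
  then obtain d where d: "b = 2 * d + 1" by (rule oddE)
  show ?thesis by (rule that[of c]) (use assms in \<open>auto simp: half_hook_def c d\<close>)
qed

text \<open>With the size fixed, a negative arm means a leg of at least \<open>2 ^ k\<close>, where
  \<open>hook_mult\<close> vanishes; the two conventions agree.\<close>

lemma hook_r_hook_mult:
  assumes "x + y + 1 = 2 ^ k" "y \<ge> 0"
  shows "hook_r k x y U = hook_mult k (nat y) U"
proof (cases "x < 0")
  case True
  then have "nat y \<ge> 2 ^ k" using assms by (simp add: le_nat_iff)
  then show ?thesis using True by (simp add: hook_r_def hook_mult_eq_0)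
next
  case False
  then have "int (nat x + nat y + 1) = int (2 ^ k)" using assms by simp
  then have "nat x + nat y + 1 = 2 ^ k" by (simp only: of_nat_eq_iff)
  then show ?thesis using False assms by (simp add: hook_r_def mult_r_hook)
qed

text \<open>The bound \<open>2 * b1 < b\<close> keeps both partner legs nonnegative, so integer and
  truncated subtraction coincide.\<close>

lemma partner_r_hook_mult:
  assumes ab: "a + b + 1 = 2 * 2 ^ k" and ab1: "a1 + b1 + 1 = 2 ^ k" and b1: "2 * b1 < b"
  shows "partner_r k (a, b) (a1, b1) U
    = (if b1 \<noteq> b div 2 then hook_mult k (b - 1 - b1) U else 0) + hook_mult k (b - b1) U"
proof -
  obtain a' where a': "half_hook (a, b) = (a', b div 2)" "a' + b div 2 + 1 = 2 ^ k"
    using ab by (rule half_hook_eq)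
  have half: "(a1, b1) = half_hook (a, b) \<longleftrightarrow> b1 = b div 2" using a' ab1 by auto
  have int: "int a + int b + 1 = 2 * 2 ^ k" "int a1 + int b1 + 1 = 2 ^ k"
    using arg_cong[OF ab, of int] arg_cong[OF ab1, of int] by simp_all
  have "hook_r k (int a - int a1) (int b - int b1 - 1) U = hook_mult k (nat (int b - int b1 - 1)) U"
    by (rule hook_r_hook_mult) (use int b1 in auto)
  moreover have "hook_r k (int a - int a1 - 1) (int b - int b1) U = hook_mult k (nat (int b - int b1)) U"
    by (rule hook_r_hook_mult) (use int b1 in auto)
  moreover have "nat (int b - int b1 - 1) = b - 1 - b1" "nat (int b - int b1) = b - b1"
    using b1 by auto
  ultimately show ?thesis unfolding partner_r_def by (simp add: half del: split_paired_All)
qed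

text \<open>With the sizes given, \<open>a \<le> 2 * a1\<close> is equivalent to
  \<open>2 * b1 < b\<close>, and \<open>a1 \<le> a\<close> to \<open>b \<le> 2 ^ k + b1\<close>.
  Legs in the range \<open>2 * i < b\<close> that belong to no admissible hook contribute 0 by
  \<open>g0\<close>.\<close>

lemma sum_hook_range:
  fixes f :: "nat \<Rightarrow> nat \<Rightarrow> complex"
  assumes ab: "a + b + 1 = 2 * 2 ^ k"
    and f: "\<And>a1 b1. a1 + b1 + 1 = 2 ^ k \<Longrightarrow> 2 * b1 < b \<Longrightarrow> f a1 b1 = g b1"
    and g0: "\<And>i. i \<ge> 2 ^ k \<or> b > 2 ^ k + i \<Longrightarrow> g i = 0"
  shows "(\<Sum>(a1, b1)\<in>hook_range k a. f a1 b1) = (\<Sum>i | 2 * i < b. g i)"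
proof -
  define M :: nat where "M = 2 ^ k"
  have range: "(a1, b1) \<in> hook_range k a \<longleftrightarrow> a1 + b1 + 1 = M \<and> a1 \<le> a \<and> a \<le> 2 * a1" for a1 b1
  proof -
    have "real a / 2 \<le> real a1 \<longleftrightarrow> real a \<le> real (2 * a1)" by (simp add: divide_le_eq mult.commute)
    also have "\<dots> \<longleftrightarrow> a \<le> 2 * a1" by (rule of_nat_le_iff)
    finally show ?thesis unfolding hook_range_def M_def by blast
  qed
  note ab = ab[folded M_def] and f = f[folded M_def] and g0 = g0[folded M_def]
  have "(\<Sum>(a1, b1)\<in>hook_range k a. f a1 b1) = (\<Sum>i | 2 * i < b \<and> i < M \<and> b \<le> M + i. g i)"
  proof (rule sum.reindex_bij_witness[of _ "\<lambda>i. (M - 1 - i, i)" snd])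
    fix q assume q: "q \<in> hook_range k a"
    obtain a1 b1 where ab1: "q = (a1, b1)" by (cases q)
    then have *: "a1 + b1 + 1 = M" "a1 \<le> a" "a \<le> 2 * a1" using q range by auto
    then have b1: "2 * b1 < b" using ab by linarith
    show "(M - 1 - snd q, snd q) = q" using ab1 * by auto
    show "snd q \<in> {i. 2 * i < b \<and> i < M \<and> b \<le> M + i}" using ab1 * ab b1 by auto
    show "g (snd q) = (case q of (a1, b1) \<Rightarrow> f a1 b1)" using ab1 f[OF *(1) b1] by simp
  next
    fix i assume i: "i \<in> {i. 2 * i < b \<and> i < M \<and> b \<le> M + i}"
    show "snd (M - 1 - i, i) = i" by simp
    have "M - 1 - i + i + 1 = M" using i by auto
    moreover from this have "M - 1 - i \<le> a" "a \<le> 2 * (M - 1 - i)" using i ab by auto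
    ultimately show "(M - 1 - i, i) \<in> hook_range k a" by (simp only: range simp_thms)
  qed
  also have "\<dots> = (\<Sum>i | 2 * i < b. g i)"
  proof (rule sum.mono_neutral_left)
    show "finite {i. 2 * i < b}" by (auto intro: finite_subset[of _ "{..b}"])
    show "\<forall>i\<in>{i. 2 * i < b} - {i. 2 * i < b \<and> i < M \<and> b \<le> M + i}. g i = 0"
    proof
      fix i assume "i \<in> {i. 2 * i < b} - {i. 2 * i < b \<and> i < M \<and> b \<le> M + i}"
      then have "i \<ge> M \<or> b > M + i" by auto
      then show "g i = 0" by (rule g0)
    qed
  qed auto
  finally show ?thesis .
qed

lemma B_sum_eq:
  assumes ab: "a + b + 1 = 2 * 2 ^ k"
  shows "B_sum k T1 T2 (a, b) + hook_mult k (b div 2) T1 * hook_mult k (b div 2) T2 = pair_mult k b T1 T2"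
proof -
  have "B_sum k T1 T2 (a, b)
    = (\<Sum>i | 2 * i < b. hook_mult k i T1 * ((if i \<noteq> b div 2 then hook_mult k (b - 1 - i) T2 else 0)
          + hook_mult k (b - i) T2)
        + hook_mult k i T2 * ((if i \<noteq> b div 2 then hook_mult k (b - 1 - i) T1 else 0)
          + hook_mult k (b - i) T1))"
    unfolding B_sum_def prod.case
  proof (rule sum_hook_range[OF ab])
    fix i assume "i \<ge> 2 ^ k \<or> b > 2 ^ k + i"
    \<comment> \<open>Either the hook with leg \<open>i\<close> does not exist, or both of its
      partners have too long a leg.\<close>
    then consider "i \<ge> 2 ^ k" | "b - 1 - i \<ge> 2 ^ k" "b - i \<ge> 2 ^ k" by linarith
    then show "hook_mult k i T1 * ((if i \<noteq> b div 2 then hook_mult k (b - 1 - i) T2 else 0)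
          + hook_mult k (b - i) T2)
        + hook_mult k i T2 * ((if i \<noteq> b div 2 then hook_mult k (b - 1 - i) T1 else 0)
          + hook_mult k (b - i) T1) = 0"
      by cases (simp_all add: hook_mult_eq_0)
  qed (simp add: partner_r_hook_mult[OF ab] mult_r_hook)
  then show ?thesis unfolding pair_mult_eq_half_sum by simp
qed

lemma B_sum_same: "B_sum k T1 T1 q = 2 * A_sum k T1 q"
  by (cases q) (simp add: B_sum_def A_sum_def sum_distrib_left case_prod_unfold)

theorem theorem5p1:
  fixes k a b :: nat and T :: tree
  assumes "k \<ge> 1"
    and "a + b + 1 = 2 ^ k"
    and "tree12 k T"
  shows "(\<forall>T1. T = Node {#T1, T1#} \<or> T = Node {#T1#} \<longrightarrow>
            mult_r k (hook (a, b)) T =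
              A_sum (k - 1) T1 (a, b)
              + 1 / 2 * (mult_r (k - 1) (hook (half_hook (a, b))) T1)\<^sup>2
              + ext_sign T * (-1) ^ vert (hook (a, b)) / 2
                * mult_r (k - 1) (hook (half_hook (a, b))) T1)
       \<and> (\<forall>T1 T2. T = Node {#T1, T2#} \<and> T1 \<noteq> T2 \<longrightarrow>
            mult_r k (hook (a, b)) T =
              B_sum (k - 1) T1 T2 (a, b)
              + mult_r (k - 1) (hook (half_hook (a, b))) T1
                * mult_r (k - 1) (hook (half_hook (a, b))) T2)"
proof -
  obtain l where k: "k = Suc l" using assms(1) by (cases k) auto
  have ab: "a + b + 1 = 2 * 2 ^ l" using assms(2) by (simp add: k)
  have odd: "odd (a + b)"
  proof -
    have "even (a + b + 1)" unfolding ab by simp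
    then show ?thesis by simp
  qed
  obtain a' where a': "half_hook (a, b) = (a', b div 2)" "a' + b div 2 + 1 = 2 ^ l"
    using ab by (rule half_hook_eq)
  have half: "mult_r l (hook (half_hook (a, b))) U = hook_mult l (b div 2) U" for U
    unfolding a'(1) by (rule mult_r_hook[OF a'(2)])
  have T: "mult_r (Suc l) (hook (a, b)) T = hook_mult (Suc l) b T"
    using mult_r_hook[OF assms(2)] by (simp add: k)
  \<comment> \<open>Half of \<open>B_sum_eq\<close> for equal subtrees: each term of
    \<open>A_sum\<close> occurs twice in \<open>B_sum\<close>, and the middle product becomes half a
    square.\<close>
  have A: "A_sum l T1 (a, b) + 1 / 2 * (hook_mult l (b div 2) T1)\<^sup>2 = pair_mult l b T1 T1 / 2" for T1
    using B_sum_eq[OF ab, of T1 T1] unfolding B_sum_same by (simp add: power2_eq_square field_simps)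
  show ?thesis
  proof (intro conjI allI impI)
    fix T1 assume T1: "T = Node {#T1, T1#} \<or> T = Node {#T1#}"
    have "tree_char (Suc l) T = ext_char l (ext_sign T) (tree_char l T1)"
      using T1
    proof
      assume "T = Node {#T1, T1#}"
      moreover from this have "ext_sign T = 1" by (auto simp: ext_sign_def)
      ultimately show ?thesis by (simp only: tree_char_double)
    next
      assume "T = Node {#T1#}"
      moreover from this have "ext_sign T = - 1" by (auto simp: ext_sign_def)
      ultimately show ?thesis by (simp only: tree_char_single)
    qed
    then show "mult_r k (hook (a, b)) T = A_sum (k - 1) T1 (a, b)
        + 1 / 2 * (mult_r (k - 1) (hook (half_hook (a, b))) T1)\<^sup>2
        + ext_sign T * (-1) ^ vert (hook (a, b)) / 2 * mult_r (k - 1) (hook (half_hook (a, b))) T1"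
      unfolding k T diff_Suc_1 half A vert_hook[OF odd] by (rule hook_mult_ext)
  next
    fix T1 T2 assume "T = Node {#T1, T2#} \<and> T1 \<noteq> T2"
    then have T12: "T = Node {#T1, T2#}" "T1 \<noteq> T2" by auto
    obtain U V where UV: "(U, V) = (T1, T2) \<or> (U, V) = (T2, T1)"
      "tree_char (Suc l) (Node {#T1, T2#}) = induced_char (H_group (Suc l)) (base_subgroup l)
        (outer_tensor (tree_char l U) (tree_char l V))"
      using T12(2) by (rule tree_char_pair)
    have "hook_mult (Suc l) b T = pair_mult l b U V"
      unfolding T12(1) using UV(2) by (rule hook_mult_ind)
    also have "\<dots> = pair_mult l b T1 T2" using UV(1) pair_mult_commute by auto
    finally show "mult_r k (hook (a, b)) T = B_sum (k - 1) T1 T2 (a, b)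
        + mult_r (k - 1) (hook (half_hook (a, b))) T1 * mult_r (k - 1) (hook (half_hook (a, b))) T2"
      unfolding k T diff_Suc_1 half B_sum_eq[OF ab] .
  qed
qed

end
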